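(* Let $k$ be an arbitrary field and let $H$ be a Hopf algebra over $k$ with antipode $S$. Then $S$, regarded as a morphism from $H$ to $H^{op,cop}$ in the category $\mathrm{HopfAlg}$, is both an epimorphism and a monomorphism in $\mathrm{HopfAlg}$.
   Context: $\mathrm{HopfAlg}$ denotes the category of Hopf algebras over $k$. $H^{op,cop}$ denotes $H$ with the opposite multiplication and the coopposite comultiplication; it is again a Hopf algebra, and $S:H\to H^{op,cop}$ is a map of Hopf algebras. Epimorphism and monomorphism are meant in the categorical sense. *)

theory Defs
  imports Complex_Main "HOL-Algebra.Module" "HOL-Algebra.AbelCoset"
begin

section \<open>Tensor products of modules\<close>

definition linear_maps ::
    "('k, 'r) ring_scheme \<Rightarrow> ('k, 'a, 'm) module_scheme \<Rightarrow> ('k, 'b, 'n) module_scheme \<Rightarrow> ('a \<Rightarrow> 'b) set"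
  where "linear_maps R M N =
    {f \<in> carrier M \<rightarrow> carrier N.
      (\<forall>x\<in>carrier M. \<forall>y\<in>carrier M. f (x \<oplus>\<^bsub>M\<^esub> y) = f x \<oplus>\<^bsub>N\<^esub> f y) \<and>
      (\<forall>c\<in>carrier R. \<forall>x\<in>carrier M. f (c \<odot>\<^bsub>M\<^esub> x) = c \<odot>\<^bsub>N\<^esub> f x)}"

definition ground :: "('k, 'r) ring_scheme \<Rightarrow> ('k, 'k) module"
  where "ground R = \<lparr>carrier = carrier R, mult = mult R, one = one R, zero = zero R, add = add R,
    smult = mult R\<rparr>"

text \<open>The records \<open>free_module\<close> and \<open>tensor_space\<close> are used only as modules; their ring fields
  \<open>mult\<close> and \<open>one\<close> carry no information.\<close>

definition free_module :: "('k, 'r) ring_scheme \<Rightarrow> 'x set \<Rightarrow> ('k, 'x \<Rightarrow> 'k) module"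
  where "free_module R X =
    \<lparr>carrier = {u. (\<forall>x\<in>X. u x \<in> carrier R) \<and> (\<forall>x. x \<notin> X \<longrightarrow> u x = \<zero>\<^bsub>R\<^esub>) \<and>
                   finite {x. u x \<noteq> \<zero>\<^bsub>R\<^esub>}},
     mult = undefined, one = undefined,
     zero = (\<lambda>x. \<zero>\<^bsub>R\<^esub>), add = (\<lambda>u v x. u x \<oplus>\<^bsub>R\<^esub> v x),
     smult = (\<lambda>c u x. c \<otimes>\<^bsub>R\<^esub> u x)\<rparr>"

definition free_basis :: "('k, 'r) ring_scheme \<Rightarrow> 'x \<Rightarrow> 'x \<Rightarrow> 'k"
  where "free_basis R x = (\<lambda>y. if y = x then \<one>\<^bsub>R\<^esub> else \<zero>\<^bsub>R\<^esub>)"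

definition bilinear_relations ::
    "('k, 'r) ring_scheme \<Rightarrow> ('k, 'a, 'm) module_scheme \<Rightarrow> ('k, 'b, 'n) module_scheme \<Rightarrow>
      ('a \<times> 'b \<Rightarrow> 'k) set"
  where "bilinear_relations R M N =
    (let F = free_module R (carrier M \<times> carrier N); e = (\<lambda>x y. free_basis R (x, y)) in
       {e (x \<oplus>\<^bsub>M\<^esub> x') y \<ominus>\<^bsub>F\<^esub> (e x y \<oplus>\<^bsub>F\<^esub> e x' y) | x x' y.
          x \<in> carrier M \<and> x' \<in> carrier M \<and> y \<in> carrier N} \<union>
       {e x (y \<oplus>\<^bsub>N\<^esub> y') \<ominus>\<^bsub>F\<^esub> (e x y \<oplus>\<^bsub>F\<^esub> e x y') | x y y'.
          x \<in> carrier M \<and> y \<in> carrier N \<and> y' \<in> carrier N} \<union>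
       {e (c \<odot>\<^bsub>M\<^esub> x) y \<ominus>\<^bsub>F\<^esub> (c \<odot>\<^bsub>F\<^esub> e x y) | c x y.
          c \<in> carrier R \<and> x \<in> carrier M \<and> y \<in> carrier N} \<union>
       {e x (c \<odot>\<^bsub>N\<^esub> y) \<ominus>\<^bsub>F\<^esub> (c \<odot>\<^bsub>F\<^esub> e x y) | c x y.
          c \<in> carrier R \<and> x \<in> carrier M \<and> y \<in> carrier N})"

definition bilinear_submodule ::
    "('k, 'r) ring_scheme \<Rightarrow> ('k, 'a, 'm) module_scheme \<Rightarrow> ('k, 'b, 'n) module_scheme \<Rightarrow>
      ('a \<times> 'b \<Rightarrow> 'k) set"
  where "bilinear_submodule R M N =
    (\<lambda>U. submodule U R (free_module R (carrier M \<times> carrier N))) hull bilinear_relations R M N"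

type_synonym ('k, 'a, 'b) tensor = "('a \<times> 'b \<Rightarrow> 'k) set"

definition tensor_space ::
    "('k, 'r) ring_scheme \<Rightarrow> ('k, 'a, 'm) module_scheme \<Rightarrow> ('k, 'b, 'n) module_scheme \<Rightarrow>
      ('k, ('k, 'a, 'b) tensor) module"
  where "tensor_space R M N =
    (let F = free_module R (carrier M \<times> carrier N); I = bilinear_submodule R M N in
      \<lparr>carrier = a_rcosets\<^bsub>F\<^esub> I, mult = undefined, one = undefined,
       zero = I, add = set_add F,
       smult = (\<lambda>c t. \<Union>u\<in>t. I +>\<^bsub>F\<^esub> (c \<odot>\<^bsub>F\<^esub> u))\<rparr>)"

definition pure_tensor ::
    "('k, 'r) ring_scheme \<Rightarrow> ('k, 'a, 'm) module_scheme \<Rightarrow> ('k, 'b, 'n) module_scheme \<Rightarrow>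
      'a \<Rightarrow> 'b \<Rightarrow> ('k, 'a, 'b) tensor"
  where "pure_tensor R M N x y =
    bilinear_submodule R M N +>\<^bsub>free_module R (carrier M \<times> carrier N)\<^esub> free_basis R (x, y)"

text \<open>The linear map \<open>M \<otimes> N \<rightarrow> P\<close> that sends \<open>x \<otimes> y\<close> to \<open>b x y\<close>, meant for bilinear \<open>b\<close>: then
  the linear extension of \<open>b\<close> to the free module is constant on each coset \<open>t\<close>.\<close>

definition tensor_lift ::
    "('k, 'r) ring_scheme \<Rightarrow> ('k, 'c, 'p) module_scheme \<Rightarrow> ('a \<Rightarrow> 'b \<Rightarrow> 'c) \<Rightarrow>
      ('k, 'a, 'b) tensor \<Rightarrow> 'c"
  where "tensor_lift R P b t =
    the_elem ((\<lambda>u. \<Oplus>\<^bsub>P\<^esub>p\<in>{p. u p \<noteq> \<zero>\<^bsub>R\<^esub>}. u p \<odot>\<^bsub>P\<^esub> b (fst p) (snd p)) ` t)"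

text \<open>The map \<open>f \<otimes> g : M \<otimes> N \<rightarrow> M' \<otimes> N'\<close>; only the target modules \<open>M'\<close>, \<open>N'\<close> are needed as
  parameters.\<close>

definition tensor_map ::
    "('k, 'r) ring_scheme \<Rightarrow> ('k, 'c, 'm) module_scheme \<Rightarrow> ('k, 'd, 'n) module_scheme \<Rightarrow>
      ('a \<Rightarrow> 'c) \<Rightarrow> ('b \<Rightarrow> 'd) \<Rightarrow> ('k, 'a, 'b) tensor \<Rightarrow> ('k, 'c, 'd) tensor"
  where "tensor_map R M' N' f g =
    tensor_lift R (tensor_space R M' N') (\<lambda>x y. pure_tensor R M' N' (f x) (g y))"

definition tensor_flip ::
    "('k, 'r) ring_scheme \<Rightarrow> ('k, 'a, 'm) module_scheme \<Rightarrow> ('k, 'b, 'n) module_scheme \<Rightarrow>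
      ('k, 'a, 'b) tensor \<Rightarrow> ('k, 'b, 'a) tensor"
  where "tensor_flip R M N =
    tensor_lift R (tensor_space R N M) (\<lambda>x y. pure_tensor R N M y x)"

text \<open>The associativity isomorphism \<open>(M \<otimes> N) \<otimes> P \<rightarrow> M \<otimes> (N \<otimes> P)\<close>.\<close>

definition tensor_assoc ::
    "('k, 'r) ring_scheme \<Rightarrow> ('k, 'a, 'm) module_scheme \<Rightarrow> ('k, 'b, 'n) module_scheme \<Rightarrow>
      ('k, 'c, 'p) module_scheme \<Rightarrow>
      ('k, ('k, 'a, 'b) tensor, 'c) tensor \<Rightarrow> ('k, 'a, ('k, 'b, 'c) tensor) tensor"
  where "tensor_assoc R M N P =
    (let NP = tensor_space R N P; T = tensor_space R M NP in
      tensor_lift R T (\<lambda>t z.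
        tensor_lift R T (\<lambda>x y. pure_tensor R M NP x (pure_tensor R N P y z)) t))"

text \<open>The tensor product of algebras, with \<open>(a \<otimes> b) (c \<otimes> d) = ac \<otimes> bd\<close>.\<close>

definition tensor_algebra ::
    "('k, 'r) ring_scheme \<Rightarrow> ('k, 'a, 'm) module_scheme \<Rightarrow> ('k, 'b, 'n) module_scheme \<Rightarrow>
      ('k, ('k, 'a, 'b) tensor) module"
  where "tensor_algebra R A B =
    (let T = tensor_space R A B in
      T\<lparr>mult := (\<lambda>t u. tensor_lift R T (\<lambda>a b.
                  tensor_lift R T (\<lambda>c d. pure_tensor R A B (a \<otimes>\<^bsub>A\<^esub> c) (b \<otimes>\<^bsub>B\<^esub> d)) u) t),
        one := pure_tensor R A B \<one>\<^bsub>A\<^esub> \<one>\<^bsub>B\<^esub>\<rparr>)"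


section \<open>Hopf algebras\<close>

record ('k, 'h) hopf = "('k, 'h) module" +
  comult :: "'h \<Rightarrow> ('k, 'h, 'h) tensor"
  counit :: "'h \<Rightarrow> 'k"
  antipode :: "'h \<Rightarrow> 'h"

text \<open>The locale \<open>algebra\<close> of HOL-Algebra requires a commutative multiplication, so it cannot be
  used here. In the counit and antipode laws, the composites of \<open>\<epsilon> \<otimes> id\<close> and \<open>id \<otimes> \<epsilon>\<close> with the
  identifications \<open>k \<otimes> H = H = H \<otimes> k\<close>, and of \<open>S \<otimes> id\<close> and \<open>id \<otimes> S\<close> with the multiplication
  \<open>H \<otimes> H \<rightarrow> H\<close>, are given by the bilinear maps that induce them.\<close>

locale hopf_algebra = module R H + H: ring H
  for R :: "('k, 'r) ring_scheme" and H :: "('k, 'h, 'z) hopf_scheme" +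
  assumes smult_mult_left:
      "\<lbrakk>c \<in> carrier R; x \<in> carrier H; y \<in> carrier H\<rbrakk> \<Longrightarrow>
        (c \<odot>\<^bsub>H\<^esub> x) \<otimes>\<^bsub>H\<^esub> y = c \<odot>\<^bsub>H\<^esub> (x \<otimes>\<^bsub>H\<^esub> y)"
    and smult_mult_right:
      "\<lbrakk>c \<in> carrier R; x \<in> carrier H; y \<in> carrier H\<rbrakk> \<Longrightarrow>
        x \<otimes>\<^bsub>H\<^esub> (c \<odot>\<^bsub>H\<^esub> y) = c \<odot>\<^bsub>H\<^esub> (x \<otimes>\<^bsub>H\<^esub> y)"
    and comult_linear: "comult H \<in> linear_maps R H (tensor_space R H H)"
    and counit_linear: "counit H \<in> linear_maps R H (ground R)"
    and coassoc:
      "x \<in> carrier H \<Longrightarrow>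
        tensor_assoc R H H H
          (tensor_map R (tensor_space R H H) H (comult H) (\<lambda>y. y) (comult H x)) =
        tensor_map R H (tensor_space R H H) (\<lambda>y. y) (comult H) (comult H x)"
    and counit_left:
      "x \<in> carrier H \<Longrightarrow> tensor_lift R H (\<lambda>y z. counit H y \<odot>\<^bsub>H\<^esub> z) (comult H x) = x"
    and counit_right:
      "x \<in> carrier H \<Longrightarrow> tensor_lift R H (\<lambda>y z. counit H z \<odot>\<^bsub>H\<^esub> y) (comult H x) = x"
    and comult_ring_hom: "comult H \<in> ring_hom H (tensor_algebra R H H)"
    and counit_ring_hom: "counit H \<in> ring_hom H R"
    and antipode_linear: "antipode H \<in> linear_maps R H H"
    and antipode_left:
      "x \<in> carrier H \<Longrightarrow>
        tensor_lift R H (\<lambda>y z. antipode H y \<otimes>\<^bsub>H\<^esub> z) (comult H x) = counit H x \<odot>\<^bsub>H\<^esub> \<one>\<^bsub>H\<^esub>"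
    and antipode_right:
      "x \<in> carrier H \<Longrightarrow>
        tensor_lift R H (\<lambda>y z. y \<otimes>\<^bsub>H\<^esub> antipode H z) (comult H x) = counit H x \<odot>\<^bsub>H\<^esub> \<one>\<^bsub>H\<^esub>"

text \<open>The Hopf algebra \<open>H\<^sup>o\<^sup>p\<^sup>,\<^sup>c\<^sup>o\<^sup>p\<close>, with the same unit, counit and antipode.\<close>

definition op_cop :: "('k, 'r) ring_scheme \<Rightarrow> ('k, 'h, 'z) hopf_scheme \<Rightarrow> ('k, 'h, 'z) hopf_scheme"
  where "op_cop R H =
    H\<lparr>mult := (\<lambda>x y. y \<otimes>\<^bsub>H\<^esub> x), comult := (\<lambda>x. tensor_flip R H H (comult H x))\<rparr>"


section \<open>The category of Hopf algebras\<close>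

text \<open>Morphisms are the maps of algebras and coalgebras; these commute with the antipodes
  automatically.\<close>

locale hopf_hom = H: hopf_algebra R H + K: hopf_algebra R K
  for R :: "('k, 'r) ring_scheme" and H :: "('k, 'h, 'z) hopf_scheme"
    and K :: "('k, 'l, 'y) hopf_scheme" and f :: "'h \<Rightarrow> 'l" +
  assumes hom_linear: "f \<in> linear_maps R H K"
    and hom_ring_hom: "f \<in> ring_hom H K"
    and hom_comult: "x \<in> carrier H \<Longrightarrow> comult K (f x) = tensor_map R K K f f (comult H x)"
    and hom_counit: "x \<in> carrier H \<Longrightarrow> counit K (f x) = counit H x"

text \<open>Cancellation is tested against all Hopf algebras carried by a subset of the type \<open>'t\<close>.
  The notions in the category are obtained by leaving \<open>'t\<close> arbitrary. Morphisms are
  functions on carriers, so they are compared on the carrier only.\<close>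

definition hopf_monomorphism ::
    "'t itself \<Rightarrow> ('k, 'r) ring_scheme \<Rightarrow> ('k, 'h) hopf \<Rightarrow> ('k, 'l) hopf \<Rightarrow> ('h \<Rightarrow> 'l) \<Rightarrow> bool"
  where "hopf_monomorphism TYPE('t) R H K f \<longleftrightarrow>
    hopf_hom R H K f \<and>
    (\<forall>(L :: ('k, 't) hopf) g h.
      hopf_hom R L H g \<longrightarrow> hopf_hom R L H h \<longrightarrow>
      (\<forall>x\<in>carrier L. f (g x) = f (h x)) \<longrightarrow> (\<forall>x\<in>carrier L. g x = h x))"

definition hopf_epimorphism ::
    "'t itself \<Rightarrow> ('k, 'r) ring_scheme \<Rightarrow> ('k, 'h) hopf \<Rightarrow> ('k, 'l) hopf \<Rightarrow> ('h \<Rightarrow> 'l) \<Rightarrow> bool"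
  where "hopf_epimorphism TYPE('t) R H K f \<longleftrightarrow>
    hopf_hom R H K f \<and>
    (\<forall>(L :: ('k, 't) hopf) g h.
      hopf_hom R K L g \<longrightarrow> hopf_hom R K L h \<longrightarrow>
      (\<forall>x\<in>carrier H. g (f x) = h (f x)) \<longrightarrow> (\<forall>x\<in>carrier K. g x = h x))"

end

theory Submission
  imports Defs
begin

text \<open>
  The antipode is cancellable on both sides because composing it with a morphism produces an inverse
  of that morphism. For a Hopf algebra \<open>L\<close> and an algebra \<open>A\<close>, the linear maps from \<open>L\<close> to \<open>A\<close>
  form a monoid under convolution, where the product of \<open>f\<close> and \<open>g\<close> sends \<open>x\<close> to
  \<open>\<Sum> f x\<^sub>1 g x\<^sub>2\<close> and the unit sends \<open>x\<close> to \<open>\<epsilon> x \<one>\<close>. An element of a monoid is determined by its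
  inverse (\<open>convolution_inverse_unique\<close>).

  If \<open>g : L \<rightarrow> H\<close> is a morphism, then \<open>S \<circ> g\<close> is the inverse of \<open>g\<close>, because \<open>g\<close> respects the
  comultiplications: \<open>\<Sum> S (g x\<^sub>1) g x\<^sub>2\<close> is the antipode law of \<open>H\<close> at \<open>g x\<close>. So \<open>S \<circ> g = S \<circ> h\<close>
  forces \<open>g = h\<close>, and \<open>S\<close> is a monomorphism. If \<open>g : K \<rightarrow> L\<close> is a morphism, then \<open>g \<circ> S\<^sub>K\<close> is the
  inverse of \<open>g\<close>, because \<open>g\<close> respects products: \<open>\<Sum> g (S x\<^sub>1) g x\<^sub>2\<close> is the image of the antipode
  law of \<open>K\<close> at \<open>x\<close>. With \<open>K = H\<^sup>o\<^sup>p\<^sup>,\<^sup>c\<^sup>o\<^sup>p\<close>, whose antipode is again \<open>S\<close>, this shows that \<open>S\<close> is an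
  epimorphism.

  It remains to see that \<open>H\<^sup>o\<^sup>p\<^sup>,\<^sup>c\<^sup>o\<^sup>p\<close> is a Hopf algebra (\<open>hopf_algebra_op_cop\<close>) and that \<open>S\<close> is a
  morphism into it (\<open>antipode_hopf_hom\<close>), that is, that \<open>S\<close> reverses products and coproducts
  (\<open>antipode_mult\<close>, \<open>comult_antipode\<close>). These are cancellations in convolution monoids, too.

  All calculations are done with Sweedler sums \<open>\<Sum> b x\<^sub>1 x\<^sub>2\<close> for bilinear \<open>b\<close>. They rest on the
  universal property of the tensor product: a bilinear map lifts to a linear map
  (\<open>tensor_lift_linear\<close>, \<open>tensor_lift_pure\<close>), and linear maps on a tensor product agree as soon as
  they agree on pure tensors (\<open>linear_maps_tensor_eqI\<close>).\<close>

section \<open>Linear and bilinear maps\<close>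

lemma linear_mapsI:
  assumes "\<And>x. x \<in> carrier M \<Longrightarrow> f x \<in> carrier N"
    and "\<And>x y. \<lbrakk>x \<in> carrier M; y \<in> carrier M\<rbrakk> \<Longrightarrow> f (x \<oplus>\<^bsub>M\<^esub> y) = f x \<oplus>\<^bsub>N\<^esub> f y"
    and "\<And>c x. \<lbrakk>c \<in> carrier R; x \<in> carrier M\<rbrakk> \<Longrightarrow> f (c \<odot>\<^bsub>M\<^esub> x) = c \<odot>\<^bsub>N\<^esub> f x"
  shows "f \<in> linear_maps R M N"
  using assms by (auto simp: linear_maps_def)

lemma linear_maps_closed: "\<lbrakk>f \<in> linear_maps R M N; x \<in> carrier M\<rbrakk> \<Longrightarrow> f x \<in> carrier N"
  by (auto simp: linear_maps_def)

lemma linear_maps_add: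
  "\<lbrakk>f \<in> linear_maps R M N; x \<in> carrier M; y \<in> carrier M\<rbrakk> \<Longrightarrow> f (x \<oplus>\<^bsub>M\<^esub> y) = f x \<oplus>\<^bsub>N\<^esub> f y"
  by (auto simp: linear_maps_def)

lemma linear_maps_smult:
  "\<lbrakk>f \<in> linear_maps R M N; c \<in> carrier R; x \<in> carrier M\<rbrakk> \<Longrightarrow> f (c \<odot>\<^bsub>M\<^esub> x) = c \<odot>\<^bsub>N\<^esub> f x"
  by (auto simp: linear_maps_def)

lemma linear_maps_zero:
  assumes "module R M" "module R N" "f \<in> linear_maps R M N"
  shows "f \<zero>\<^bsub>M\<^esub> = \<zero>\<^bsub>N\<^esub>"
proof -
  interpret M: module R M by fact
  interpret N: module R N by fact
  have "f (\<zero>\<^bsub>R\<^esub> \<odot>\<^bsub>M\<^esub> \<zero>\<^bsub>M\<^esub>) = \<zero>\<^bsub>R\<^esub> \<odot>\<^bsub>N\<^esub> f \<zero>\<^bsub>M\<^esub>"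
    by (rule linear_maps_smult[OF assms(3)]) auto
  then show ?thesis using linear_maps_closed[OF assms(3)] by simp
qed

lemma linear_maps_id: "(\<lambda>x. x) \<in> linear_maps R M M"
  by (rule linear_mapsI) auto

lemma linear_maps_compose:
  "\<lbrakk>f \<in> linear_maps R N P; g \<in> linear_maps R M N\<rbrakk> \<Longrightarrow> (\<lambda>x. f (g x)) \<in> linear_maps R M P"
  by (rule linear_mapsI)
    (simp_all add: linear_maps_closed linear_maps_add linear_maps_smult)

lemma linear_maps_plus:
  assumes "module R N" "f \<in> linear_maps R M N" "g \<in> linear_maps R M N"
  shows "(\<lambda>x. f x \<oplus>\<^bsub>N\<^esub> g x) \<in> linear_maps R M N"
proof -
  interpret N: module R N by fact
  show ?thesis
    using assms(2,3)
    by (intro linear_mapsI)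
      (simp_all add: linear_maps_closed linear_maps_add linear_maps_smult N.smult_r_distr N.a_ac)
qed

lemma linear_maps_smult_const:
  assumes "module R N" "f \<in> linear_maps R M N" "c \<in> carrier R"
  shows "(\<lambda>x. c \<odot>\<^bsub>N\<^esub> f x) \<in> linear_maps R M N"
proof -
  interpret N: module R N by fact
  show ?thesis
    using assms(2,3)
    by (intro linear_mapsI)
      (simp_all add: linear_maps_closed linear_maps_add linear_maps_smult N.smult_r_distr
        N.smult_assoc1[symmetric] N.R.m_comm)
qed

lemma linear_maps_scalar:
  assumes "module R N" "f \<in> linear_maps R M (ground R)" "y \<in> carrier N"
  shows "(\<lambda>x. f x \<odot>\<^bsub>N\<^esub> y) \<in> linear_maps R M N"
proof -
  interpret N: module R N by fact
  have *: "f x \<in> carrier R" if "x \<in> carrier M" for x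
    using linear_maps_closed[OF assms(2) that] by (simp add: ground_def)
  show ?thesis
    using assms(2,3) *
    by (intro linear_mapsI)
      (simp_all add: linear_maps_add linear_maps_smult ground_def N.smult_l_distr N.smult_assoc1)
qed

lemma submodule_kernel:
  assumes "module R M" "module R N" "f \<in> linear_maps R M N"
  shows "submodule {x \<in> carrier M. f x = \<zero>\<^bsub>N\<^esub>} R M"
proof -
  interpret M: module R M by fact
  interpret N: module R N by fact
  note f = linear_maps_add[OF assms(3)] linear_maps_smult[OF assms(3)] linear_maps_zero[OF assms]
  have neg: "f (\<ominus>\<^bsub>M\<^esub> a) = \<zero>\<^bsub>N\<^esub>" if "a \<in> carrier M" "f a = \<zero>\<^bsub>N\<^esub>" for a
  proof -
    have "\<ominus>\<^bsub>M\<^esub> a = (\<ominus>\<^bsub>R\<^esub> \<one>\<^bsub>R\<^esub>) \<odot>\<^bsub>M\<^esub> a"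
      using that M.smult_l_minus[of "\<one>\<^bsub>R\<^esub>" a] by simp
    then show ?thesis using that by (simp add: f)
  qed
  show ?thesis
    by (rule M.submoduleI) (auto simp: f neg)
qed

lemma module_ground:
  assumes "cring R"
  shows "module R (ground R)"
proof -
  interpret R: cring R by fact
  show ?thesis
  proof (rule moduleI[OF assms abelian_groupI])
    fix x assume "x \<in> carrier (ground R)"
    then show "\<exists>y\<in>carrier (ground R). y \<oplus>\<^bsub>ground R\<^esub> x = \<zero>\<^bsub>ground R\<^esub>"
      by (intro bexI[of _ "\<ominus>\<^bsub>R\<^esub> x"]) (simp_all add: ground_def R.l_neg)
  qed (simp_all add: ground_def R.a_ac R.m_assoc R.l_distr R.r_distr)
qed

text \<open>Bilinearity is linearity in each variable separately, so that the closure properties of linear maps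
  in one variable settle bilinearity as well.\<close>

definition bilinear_maps ::
    "('k, 'r) ring_scheme \<Rightarrow> ('k, 'a, 'm) module_scheme \<Rightarrow> ('k, 'b, 'n) module_scheme \<Rightarrow>
      ('k, 'c, 'p) module_scheme \<Rightarrow> ('a \<Rightarrow> 'b \<Rightarrow> 'c) set"
  where "bilinear_maps R M N P =
    {b. (\<forall>x\<in>carrier M. b x \<in> linear_maps R N P) \<and>
        (\<forall>y\<in>carrier N. (\<lambda>x. b x y) \<in> linear_maps R M P)}"

lemma bilinear_mapsI:
  assumes "\<And>x. x \<in> carrier M \<Longrightarrow> (\<lambda>y. b x y) \<in> linear_maps R N P"
    and "\<And>y. y \<in> carrier N \<Longrightarrow> (\<lambda>x. b x y) \<in> linear_maps R M P"
  shows "b \<in> bilinear_maps R M N P"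
  using assms by (auto simp: bilinear_maps_def)

lemma bilinear_maps_left:
  "\<lbrakk>b \<in> bilinear_maps R M N P; y \<in> carrier N\<rbrakk> \<Longrightarrow> (\<lambda>x. b x y) \<in> linear_maps R M P"
  by (auto simp: bilinear_maps_def)

lemma bilinear_maps_right:
  "\<lbrakk>b \<in> bilinear_maps R M N P; x \<in> carrier M\<rbrakk> \<Longrightarrow> b x \<in> linear_maps R N P"
  by (auto simp: bilinear_maps_def)

lemma bilinear_maps_closed:
  "\<lbrakk>b \<in> bilinear_maps R M N P; x \<in> carrier M; y \<in> carrier N\<rbrakk> \<Longrightarrow> b x y \<in> carrier P"
  by (blast dest: bilinear_maps_right linear_maps_closed)

lemma linear_maps_cong:
  assumes "module R M" "f \<in> linear_maps R M N" "\<And>x. x \<in> carrier M \<Longrightarrow> f x = g x"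
  shows "g \<in> linear_maps R M N"
proof -
  interpret M: module R M by fact
  have "g x = f x" if "x \<in> carrier M" for x using assms(3)[OF that] by simp
  then show ?thesis
    by (intro linear_mapsI)
      (simp_all add: linear_maps_closed[OF assms(2)] linear_maps_add[OF assms(2)]
        linear_maps_smult[OF assms(2)])
qed

lemma bilinear_maps_cong:
  assumes "module R M" "module R N" "b \<in> bilinear_maps R M N P"
    and "\<And>x y. \<lbrakk>x \<in> carrier M; y \<in> carrier N\<rbrakk> \<Longrightarrow> b x y = b' x y"
  shows "b' \<in> bilinear_maps R M N P"
proof (rule bilinear_mapsI)
  fix x assume "x \<in> carrier M"
  then show "b' x \<in> linear_maps R N P"
    by (intro linear_maps_cong[OF assms(2) bilinear_maps_right[OF assms(3)]]) (use assms(4) in blast)+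
next
  fix y assume "y \<in> carrier N"
  then show "(\<lambda>x. b' x y) \<in> linear_maps R M P"
    by (intro linear_maps_cong[OF assms(1) bilinear_maps_left[OF assms(3)]]) (use assms(4) in blast)+
qed

lemma bilinear_maps_compose:
  assumes "f \<in> linear_maps R P Q" "b \<in> bilinear_maps R M N P"
  shows "(\<lambda>x y. f (b x y)) \<in> bilinear_maps R M N Q"
  by (intro bilinear_mapsI linear_maps_compose[OF assms(1)])
    (auto intro: bilinear_maps_left[OF assms(2)] bilinear_maps_right[OF assms(2)])

lemma bilinear_maps_precompose:
  assumes "b \<in> bilinear_maps R M' N' P" "f \<in> linear_maps R M M'" "g \<in> linear_maps R N N'"
  shows "(\<lambda>x y. b (f x) (g y)) \<in> bilinear_maps R M N P"
  by (intro bilinear_mapsI linear_maps_compose[OF bilinear_maps_right[OF assms(1)] assms(3)]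
      linear_maps_compose[OF bilinear_maps_left[OF assms(1)] assms(2)]
      linear_maps_closed[OF assms(2)] linear_maps_closed[OF assms(3)])

lemma bilinear_maps_swap:
  "b \<in> bilinear_maps R M N P \<Longrightarrow> (\<lambda>y x. b x y) \<in> bilinear_maps R N M P"
  by (intro bilinear_mapsI) (auto intro: bilinear_maps_left bilinear_maps_right)

section \<open>Free modules\<close>

lemma module_free_module:
  fixes R :: "('k, 'r) ring_scheme" and X :: "'x set"
  assumes "cring R"
  shows "module R (free_module R X)"
proof -
  interpret R: cring R by fact
  have fin: "finite {x. u x \<oplus>\<^bsub>R\<^esub> v x \<noteq> \<zero>\<^bsub>R\<^esub>}"
    if "finite {x. u x \<noteq> \<zero>\<^bsub>R\<^esub>}" "finite {x. v x \<noteq> \<zero>\<^bsub>R\<^esub>}" for u v :: "'x \<Rightarrow> 'k"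
    by (rule finite_subset[OF _ finite_UnI[OF that]]) auto
  have fin': "finite {x. c \<otimes>\<^bsub>R\<^esub> u x \<noteq> \<zero>\<^bsub>R\<^esub>}"
    if "finite {x. u x \<noteq> \<zero>\<^bsub>R\<^esub>}" "c \<in> carrier R" for u :: "'x \<Rightarrow> 'k" and c
    by (rule finite_subset[OF _ that(1)]) (use that(2) in auto)
  have car: "u x \<in> carrier R" if "\<forall>x\<in>X. u x \<in> carrier R" "\<forall>x. x \<notin> X \<longrightarrow> u x = \<zero>\<^bsub>R\<^esub>"
    for u :: "'x \<Rightarrow> 'k" and x
    using that by (cases "x \<in> X") auto
  show ?thesis
  proof (rule moduleI[OF assms abelian_groupI])
    fix u assume u: "u \<in> carrier (free_module R X)"
    show "\<exists>v\<in>carrier (free_module R X).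
        v \<oplus>\<^bsub>free_module R X\<^esub> u = \<zero>\<^bsub>free_module R X\<^esub>"
    proof
      have "finite {x. \<ominus>\<^bsub>R\<^esub> u x \<noteq> \<zero>\<^bsub>R\<^esub>}"
        by (rule finite_subset[of _ "{x. u x \<noteq> \<zero>\<^bsub>R\<^esub>}"])
          (use u in \<open>auto simp: free_module_def\<close>)
      then show "(\<lambda>x. \<ominus>\<^bsub>R\<^esub> u x) \<in> carrier (free_module R X)"
        using u by (auto simp: free_module_def)
      show "(\<lambda>x. \<ominus>\<^bsub>R\<^esub> u x) \<oplus>\<^bsub>free_module R X\<^esub> u = \<zero>\<^bsub>free_module R X\<^esub>"
        using u by (auto simp: free_module_def car R.l_neg)
    qed
  qed (auto simp: free_module_def fin fin' car R.a_ac R.m_ac R.r_distr R.l_distr)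
qed

lemma free_module_value:
  assumes "cring R" "u \<in> carrier (free_module R X)"
  shows "u x \<in> carrier R"
proof -
  interpret R: cring R by fact
  show ?thesis using assms(2) by (cases "x \<in> X") (auto simp: free_module_def)
qed

lemma free_basis_closed:
  assumes "cring R" "x \<in> X"
  shows "free_basis R x \<in> carrier (free_module R X)"
proof -
  interpret R: cring R by fact
  have "finite {y. free_basis R x y \<noteq> \<zero>\<^bsub>R\<^esub>}"
    by (rule finite_subset[of _ "{x}"]) (auto simp: free_basis_def)
  then show ?thesis using assms(2) by (auto simp: free_module_def free_basis_def)
qed

text \<open>The span of the basis is reached by removing the points of the support one at a time. With the
  submodule of all elements that have a given property this is an induction principle for the free
  module, and below for its quotient, the tensor product.\<close>

lemma free_module_spanned:
  assumes "cring R" and U: "submodule U R (free_module R X)"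
    and basis: "\<And>x. x \<in> X \<Longrightarrow> free_basis R x \<in> U"
  shows "carrier (free_module R X) \<subseteq> U"
proof -
  interpret R: cring R by fact
  interpret F: module R "free_module R X" by (rule module_free_module) fact
  have "u \<in> U"
    if "finite S" "u \<in> carrier (free_module R X)" "{x. u x \<noteq> \<zero>\<^bsub>R\<^esub>} \<subseteq> S" for S u
    using that
  proof (induction S arbitrary: u rule: finite_induct)
    case empty
    then have "u = \<zero>\<^bsub>free_module R X\<^esub>" by (auto simp: free_module_def)
    then show ?case using subgroup.one_closed[OF submodule.axioms(1)[OF U]] by simp
  next
    case (insert x S)
    let ?v = "u(x := \<zero>\<^bsub>R\<^esub>)"
    have fin: "finite {y. ?v y \<noteq> \<zero>\<^bsub>R\<^esub>}"
      by (rule finite_subset[of _ "{y. u y \<noteq> \<zero>\<^bsub>R\<^esub>}"])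
        (use insert.prems in \<open>auto simp: free_module_def\<close>)
    then have v: "?v \<in> carrier (free_module R X)"
      using insert.prems by (auto simp: free_module_def)
    have vU: "?v \<in> U"
      by (rule insert.IH[OF v]) (use insert.prems in auto)
    show ?case
    proof (cases "x \<in> X")
      case True
      have "u = (u x \<odot>\<^bsub>free_module R X\<^esub> free_basis R x) \<oplus>\<^bsub>free_module R X\<^esub> ?v"
        using free_module_value[OF assms(1) insert.prems(1)]
        by (auto simp: free_module_def free_basis_def)
      also have "\<dots> \<in> U"
        using F.submoduleE(4,5)[OF U] vU basis[OF True]
          free_module_value[OF assms(1) insert.prems(1)] by blast
      finally show ?thesis .
    next
      case False
      then have "?v = u" using insert.prems by (auto simp: free_module_def)
      then show ?thesis using vU by simp
    qed
  qed
  then show ?thesis by (auto simp: free_module_def)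
qed

definition free_lift ::
    "('k, 'r) ring_scheme \<Rightarrow> ('k, 'c, 'p) module_scheme \<Rightarrow> ('x \<Rightarrow> 'c) \<Rightarrow> ('x \<Rightarrow> 'k) \<Rightarrow> 'c"
  where "free_lift R P b u = (\<Oplus>\<^bsub>P\<^esub>p\<in>{p. u p \<noteq> \<zero>\<^bsub>R\<^esub>}. u p \<odot>\<^bsub>P\<^esub> b p)"

text \<open>Additivity of the linear extension compares sums over three different supports; they are all
  extended to one finite set.\<close>

lemma free_lift_superset:
  assumes "module R P" and b: "\<And>x. x \<in> X \<Longrightarrow> b x \<in> carrier P"
    and u: "u \<in> carrier (free_module R X)"
    and S: "finite S" "{x. u x \<noteq> \<zero>\<^bsub>R\<^esub>} \<subseteq> S" "S \<subseteq> X"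
  shows "free_lift R P b u = (\<Oplus>\<^bsub>P\<^esub>p\<in>S. u p \<odot>\<^bsub>P\<^esub> b p)"
proof -
  interpret P: module R P by fact
  have "u x \<in> carrier R" for x by (rule free_module_value[OF P.R.cring_axioms u])
  then show ?thesis
    unfolding free_lift_def
    by (intro P.add.finprod_mono_neutral_cong_left) (use S b in auto)
qed

lemma free_lift_linear:
  assumes "module R P" and b: "\<And>x. x \<in> X \<Longrightarrow> b x \<in> carrier P"
  shows "free_lift R P b \<in> linear_maps R (free_module R X) P"
proof -
  interpret P: module R P by fact
  interpret F: module R "free_module R X" by (rule module_free_module) (rule P.R.cring_axioms)
  note val = free_module_value[OF P.R.cring_axioms]
  have fin: "finite {x. u x \<noteq> \<zero>\<^bsub>R\<^esub>}" "{x. u x \<noteq> \<zero>\<^bsub>R\<^esub>} \<subseteq> X"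
    if "u \<in> carrier (free_module R X)" for u
    using that by (auto simp: free_module_def)
  note super = free_lift_superset[of R P X b, OF assms(1) b]
  show ?thesis
  proof (rule linear_mapsI)
    fix u assume u: "u \<in> carrier (free_module R X)"
    then show "free_lift R P b u \<in> carrier P"
      unfolding free_lift_def by (intro P.finsum_closed) (use val[OF u] fin[OF u] b in auto)
    fix c assume c: "c \<in> carrier R"
    have "free_lift R P b (c \<odot>\<^bsub>free_module R X\<^esub> u) =
        (\<Oplus>\<^bsub>P\<^esub>p\<in>{p. u p \<noteq> \<zero>\<^bsub>R\<^esub>}. (c \<odot>\<^bsub>free_module R X\<^esub> u) p \<odot>\<^bsub>P\<^esub> b p)"
      by (rule super) (use F.smult_closed[OF c u] fin[OF u] c in \<open>auto simp: free_module_def\<close>)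
    also have "\<dots> = (\<Oplus>\<^bsub>P\<^esub>p\<in>{p. u p \<noteq> \<zero>\<^bsub>R\<^esub>}. c \<odot>\<^bsub>P\<^esub> (u p \<odot>\<^bsub>P\<^esub> b p))"
      by (rule P.finsum_cong')
        (use fin[OF u] b val[OF u] c in \<open>auto simp: free_module_def P.smult_assoc1 subset_eq\<close>)
    also have "\<dots> = c \<odot>\<^bsub>P\<^esub> free_lift R P b u"
      unfolding free_lift_def
      by (rule P.finsum_smult_ldistr[symmetric]) (use fin[OF u] b val[OF u] c in auto)
    finally show "free_lift R P b (c \<odot>\<^bsub>free_module R X\<^esub> u) = c \<odot>\<^bsub>P\<^esub> free_lift R P b u" .
  next
    fix u v assume u: "u \<in> carrier (free_module R X)" and v: "v \<in> carrier (free_module R X)"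
    let ?S = "{x. u x \<noteq> \<zero>\<^bsub>R\<^esub>} \<union> {x. v x \<noteq> \<zero>\<^bsub>R\<^esub>}"
    have S: "finite ?S" "?S \<subseteq> X" using fin[OF u] fin[OF v] by auto
    have bS: "b x \<in> carrier P" if "x \<in> ?S" for x using that S b by blast
    have "free_lift R P b (u \<oplus>\<^bsub>free_module R X\<^esub> v) =
        (\<Oplus>\<^bsub>P\<^esub>p\<in>?S. (u \<oplus>\<^bsub>free_module R X\<^esub> v) p \<odot>\<^bsub>P\<^esub> b p)"
      by (rule super)
        (use F.a_closed[OF u v] S in \<open>auto simp: free_module_def\<close>)
    also have "\<dots> = (\<Oplus>\<^bsub>P\<^esub>p\<in>?S. u p \<odot>\<^bsub>P\<^esub> b p \<oplus>\<^bsub>P\<^esub> v p \<odot>\<^bsub>P\<^esub> b p)"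
      by (rule P.finsum_cong')
        (use bS val[OF u] val[OF v] in \<open>auto simp: free_module_def P.smult_l_distr\<close>)
    also have "\<dots> = (\<Oplus>\<^bsub>P\<^esub>p\<in>?S. u p \<odot>\<^bsub>P\<^esub> b p) \<oplus>\<^bsub>P\<^esub> (\<Oplus>\<^bsub>P\<^esub>p\<in>?S. v p \<odot>\<^bsub>P\<^esub> b p)"
      by (rule P.finsum_addf) (use bS val[OF u] val[OF v] in auto)
    also have "\<dots> = free_lift R P b u \<oplus>\<^bsub>P\<^esub> free_lift R P b v"
      by (subst (1 2) super[of _ ?S]) (use u v S in auto)
    finally show "free_lift R P b (u \<oplus>\<^bsub>free_module R X\<^esub> v) =
        free_lift R P b u \<oplus>\<^bsub>P\<^esub> free_lift R P b v" .
  qed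
qed

lemma free_lift_basis:
  assumes "module R P" and b: "\<And>x. x \<in> X \<Longrightarrow> b x \<in> carrier P" and x: "x \<in> X"
  shows "free_lift R P b (free_basis R x) = b x"
proof -
  interpret P: module R P by fact
  have "free_lift R P b (free_basis R x) = (\<Oplus>\<^bsub>P\<^esub>p\<in>{x}. free_basis R x p \<odot>\<^bsub>P\<^esub> b p)"
    by (rule free_lift_superset[where X = X])
      (use assms free_basis_closed[OF P.R.cring_axioms x] in \<open>auto simp: free_basis_def\<close>)
  also have "\<dots> = b x"
    by (subst P.finsum_insert) (use b x in \<open>auto simp: free_basis_def P.finsum_empty\<close>)
  finally show ?thesis .
qed

section \<open>Tensor products\<close>

locale tensor_product = M: module R M + N: module R N
  for R :: "('k, 'r) ring_scheme"
    and M :: "('k, 'a, 'm) module_scheme" and N :: "('k, 'b, 'n) module_scheme"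
begin

abbreviation "F \<equiv> free_module R (carrier M \<times> carrier N)"
abbreviation "I \<equiv> bilinear_submodule R M N"
abbreviation "T \<equiv> tensor_space R M N"
abbreviation "e x y \<equiv> free_basis R (x, y)"
abbreviation tensor (infixl \<open>\<star>\<close> 70) where "x \<star> y \<equiv> pure_tensor R M N x y"

interpretation F: module R F
  by (rule module_free_module) (rule M.R.cring_axioms)

lemma e_closed: "\<lbrakk>x \<in> carrier M; y \<in> carrier N\<rbrakk> \<Longrightarrow> e x y \<in> carrier F"
  by (rule free_basis_closed[OF M.R.cring_axioms]) auto

lemma relations_closed: "bilinear_relations R M N \<subseteq> carrier F"
  by (auto simp: bilinear_relations_def Let_def intro!: F.minus_closed F.a_closed F.smult_closed e_closed)

lemma submodule_I: "submodule I R F"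
proof -
  let ?C = "{U. submodule U R F \<and> bilinear_relations R M N \<subseteq> U}"
  have *: "I = \<Inter>?C" by (simp add: bilinear_submodule_def hull_def)
  show ?thesis
    unfolding *
  proof (rule F.submoduleI)
    show "\<Inter>?C \<subseteq> carrier F"
      using F.carrier_is_submodule relations_closed by auto
    show "\<zero>\<^bsub>F\<^esub> \<in> \<Inter>?C"
      using subgroup.one_closed[OF submodule.axioms(1)] by fastforce
  qed (auto dest: F.submoduleE)
qed

lemma relations_I: "bilinear_relations R M N \<subseteq> I"
  by (simp add: bilinear_submodule_def hull_subset)

lemma relations_in_I:
  "\<lbrakk>x \<in> carrier M; x' \<in> carrier M; y \<in> carrier N\<rbrakk> \<Longrightarrow>
    e (x \<oplus>\<^bsub>M\<^esub> x') y \<ominus>\<^bsub>F\<^esub> (e x y \<oplus>\<^bsub>F\<^esub> e x' y) \<in> I"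
  "\<lbrakk>x \<in> carrier M; y \<in> carrier N; y' \<in> carrier N\<rbrakk> \<Longrightarrow>
    e x (y \<oplus>\<^bsub>N\<^esub> y') \<ominus>\<^bsub>F\<^esub> (e x y \<oplus>\<^bsub>F\<^esub> e x y') \<in> I"
  "\<lbrakk>c \<in> carrier R; x \<in> carrier M; y \<in> carrier N\<rbrakk> \<Longrightarrow>
    e (c \<odot>\<^bsub>M\<^esub> x) y \<ominus>\<^bsub>F\<^esub> (c \<odot>\<^bsub>F\<^esub> e x y) \<in> I"
  "\<lbrakk>c \<in> carrier R; x \<in> carrier M; y \<in> carrier N\<rbrakk> \<Longrightarrow>
    e x (c \<odot>\<^bsub>N\<^esub> y) \<ominus>\<^bsub>F\<^esub> (c \<odot>\<^bsub>F\<^esub> e x y) \<in> I"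
  by (rule subsetD[OF relations_I], unfold bilinear_relations_def Let_def, blast)+

lemma I_least: "\<lbrakk>submodule U R F; bilinear_relations R M N \<subseteq> U\<rbrakk> \<Longrightarrow> I \<subseteq> U"
  by (simp add: bilinear_submodule_def hull_minimal)

interpretation I: abelian_subgroup I F
  by (rule abelian_subgroupI3)
    (auto intro!: additive_subgroup.intro submodule.axioms(1)[OF submodule_I] F.abelian_group_axioms)

abbreviation "cls u \<equiv> I +>\<^bsub>F\<^esub> u"

lemma cls_eqI:
  assumes "u \<in> carrier F" "v \<in> carrier F" "u \<ominus>\<^bsub>F\<^esub> v \<in> I"
  shows "cls u = cls v"
proof -
  have "u = (u \<ominus>\<^bsub>F\<^esub> v) \<oplus>\<^bsub>F\<^esub> v" using assms by (simp add: a_minus_def F.a_assoc F.l_neg)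
  then have "u \<in> cls v"
    using F.a_rcosI[OF assms(3) I.a_subset assms(2)] by simp
  then show ?thesis
    using F.a_repr_independence[of u I v] assms(2) I.a_subgroup by simp
qed

lemma carrier_T: "carrier T = cls ` carrier F"
  by (auto simp: tensor_space_def Let_def A_RCOSETS_def')

lemma cls_closed: "u \<in> carrier F \<Longrightarrow> cls u \<in> carrier T"
  by (simp add: carrier_T)

lemma cls_add: "\<lbrakk>u \<in> carrier F; v \<in> carrier F\<rbrakk> \<Longrightarrow> cls u \<oplus>\<^bsub>T\<^esub> cls v = cls (u \<oplus>\<^bsub>F\<^esub> v)"
  using I.a_rcos_sum by (simp add: tensor_space_def Let_def)

lemma cls_zero: "\<zero>\<^bsub>T\<^esub> = cls \<zero>\<^bsub>F\<^esub>"
  using F.a_coset_add_zero[OF I.a_subset] by (simp add: tensor_space_def Let_def)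

text \<open>The scalar multiple of a coset is a union over its representatives; it collapses because all of
  them give the same coset.\<close>

lemma cls_smult:
  assumes c: "c \<in> carrier R" and u: "u \<in> carrier F"
  shows "c \<odot>\<^bsub>T\<^esub> cls u = cls (c \<odot>\<^bsub>F\<^esub> u)"
proof -
  have "cls (c \<odot>\<^bsub>F\<^esub> v) = cls (c \<odot>\<^bsub>F\<^esub> u)" if v: "v \<in> cls u" for v
  proof -
    obtain i where i: "i \<in> I" and vi: "v = i \<oplus>\<^bsub>F\<^esub> u" using v by (auto simp: a_r_coset_def')
    have iF: "i \<in> carrier F" using i I.a_subset by auto
    have "c \<odot>\<^bsub>F\<^esub> v \<ominus>\<^bsub>F\<^esub> c \<odot>\<^bsub>F\<^esub> u = c \<odot>\<^bsub>F\<^esub> i"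
      using iF u c vi by (simp add: F.smult_r_distr a_minus_def F.a_assoc F.r_neg)
    also have "\<dots> \<in> I" by (rule F.submoduleE(4)[OF submodule_I c i])
    finally show ?thesis using iF u c vi by (intro cls_eqI) auto
  qed
  then have "(\<Union>v\<in>cls u. cls (c \<odot>\<^bsub>F\<^esub> v)) = (\<Union>v\<in>cls u. cls (c \<odot>\<^bsub>F\<^esub> u))" by blast
  also have "\<dots> = cls (c \<odot>\<^bsub>F\<^esub> u)" using I.a_rcos_self[OF u] by blast
  finally show ?thesis by (simp add: tensor_space_def Let_def)
qed

lemma module_T: "module R T"
proof (rule moduleI[OF M.R.cring_axioms abelian_groupI])
  fix t assume "t \<in> carrier T"
  then obtain u where u: "u \<in> carrier F" "t = cls u" by (auto simp: carrier_T)
  then show "\<exists>s\<in>carrier T. s \<oplus>\<^bsub>T\<^esub> t = \<zero>\<^bsub>T\<^esub>"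
    by (intro bexI[of _ "cls (\<ominus>\<^bsub>F\<^esub> u)"]) (auto simp: cls_add cls_zero F.l_neg cls_closed)
qed (auto simp: carrier_T cls_add cls_zero cls_smult F.a_ac F.smult_l_distr F.smult_r_distr
    F.smult_assoc1)

interpretation T: module R T by (rule module_T)

lemma pure_cls: "x \<star> y = cls (e x y)"
  by (simp add: pure_tensor_def)

lemma pure_tensor_closed: "\<lbrakk>x \<in> carrier M; y \<in> carrier N\<rbrakk> \<Longrightarrow> x \<star> y \<in> carrier T"
  by (simp add: pure_cls cls_closed e_closed)

lemma pure_tensor_bilinear: "pure_tensor R M N \<in> bilinear_maps R M N T"
proof -
  show ?thesis
  proof (intro bilinear_mapsI linear_mapsI)
    fix x y y' assume *: "x \<in> carrier M" "y \<in> carrier N" "y' \<in> carrier N"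
    have "cls (e x (y \<oplus>\<^bsub>N\<^esub> y')) = cls (e x y \<oplus>\<^bsub>F\<^esub> e x y')"
      by (rule cls_eqI) (use * in \<open>simp_all add: relations_in_I e_closed\<close>)
    then show "x \<star> (y \<oplus>\<^bsub>N\<^esub> y') = x \<star> y \<oplus>\<^bsub>T\<^esub> x \<star> y'"
      using * by (simp add: pure_cls cls_add e_closed)
  next
    fix x y c assume *: "x \<in> carrier M" "y \<in> carrier N" "c \<in> carrier R"
    have "cls (e x (c \<odot>\<^bsub>N\<^esub> y)) = cls (c \<odot>\<^bsub>F\<^esub> e x y)"
      by (rule cls_eqI) (use * in \<open>simp_all add: relations_in_I e_closed\<close>)
    then show "x \<star> (c \<odot>\<^bsub>N\<^esub> y) = c \<odot>\<^bsub>T\<^esub> (x \<star> y)"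
      using * by (simp add: pure_cls cls_smult e_closed)
    have "cls (e (c \<odot>\<^bsub>M\<^esub> x) y) = cls (c \<odot>\<^bsub>F\<^esub> e x y)"
      by (rule cls_eqI) (use * in \<open>simp_all add: relations_in_I e_closed\<close>)
    then show "(c \<odot>\<^bsub>M\<^esub> x) \<star> y = c \<odot>\<^bsub>T\<^esub> (x \<star> y)"
      using * by (simp add: pure_cls cls_smult e_closed)
  next
    fix x x' y assume *: "x \<in> carrier M" "x' \<in> carrier M" "y \<in> carrier N"
    have "cls (e (x \<oplus>\<^bsub>M\<^esub> x') y) = cls (e x y \<oplus>\<^bsub>F\<^esub> e x' y)"
      by (rule cls_eqI) (use * in \<open>simp_all add: relations_in_I e_closed\<close>)
    then show "(x \<oplus>\<^bsub>M\<^esub> x') \<star> y = x \<star> y \<oplus>\<^bsub>T\<^esub> x' \<star> y"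
      using * by (simp add: pure_cls cls_add e_closed)
  qed (simp_all add: pure_tensor_closed)
qed

text \<open>Pure tensors span: the elements of the free module whose cosets satisfy \<open>Q\<close> form a submodule that
  contains the basis.\<close>

lemma tensor_induct [consumes 1, case_names pure add smult]:
  assumes t: "t \<in> carrier T"
    and pure: "\<And>x y. \<lbrakk>x \<in> carrier M; y \<in> carrier N\<rbrakk> \<Longrightarrow> Q (x \<star> y)"
    and add: "\<And>s t. \<lbrakk>s \<in> carrier T; t \<in> carrier T; Q s; Q t\<rbrakk> \<Longrightarrow> Q (s \<oplus>\<^bsub>T\<^esub> t)"
    and smult: "\<And>c t. \<lbrakk>c \<in> carrier R; t \<in> carrier T; Q t\<rbrakk> \<Longrightarrow> Q (c \<odot>\<^bsub>T\<^esub> t)"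
  shows "Q t"
proof -
  let ?U = "{u \<in> carrier F. Q (cls u)}"
  have smultU: "Q (cls (c \<odot>\<^bsub>F\<^esub> u))" if "c \<in> carrier R" "u \<in> carrier F" "Q (cls u)" for c u
    using smult[of c "cls u"] that by (simp add: cls_smult cls_closed)
  \<comment> \<open>The zero tensor is a multiple of the pure tensor of two zeros.\<close>
  have zero: "Q (cls \<zero>\<^bsub>F\<^esub>)"
    using smultU[of "\<zero>\<^bsub>R\<^esub>" "e \<zero>\<^bsub>M\<^esub> \<zero>\<^bsub>N\<^esub>"] pure[of "\<zero>\<^bsub>M\<^esub>" "\<zero>\<^bsub>N\<^esub>"]
    by (simp add: e_closed pure_cls)
  have neg: "Q (cls (\<ominus>\<^bsub>F\<^esub> u))" if "u \<in> carrier F" "Q (cls u)" for u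
    using smultU[of "\<ominus>\<^bsub>R\<^esub> \<one>\<^bsub>R\<^esub>" u] that by (simp add: F.smult_l_minus)
  have "submodule ?U R F"
  proof (rule F.submoduleI)
    fix u v assume "u \<in> ?U" "v \<in> ?U"
    then show "u \<oplus>\<^bsub>F\<^esub> v \<in> ?U"
      using add[of "cls u" "cls v"] by (simp add: cls_add cls_closed)
  qed (auto simp: smultU zero neg)
  then have "carrier F \<subseteq> ?U"
    by (rule free_module_spanned[OF M.R.cring_axioms])
      (use pure in \<open>auto simp: pure_cls e_closed\<close>)
  then show ?thesis using t by (auto simp: carrier_T)
qed

text \<open>The linear extension of a bilinear map vanishes on the bilinear relations, hence on the submodule
  they generate. So it is constant on every coset, and its only value there is the value of the lift.\<close>

lemma tensor_lift_cls:
  assumes P: "module R P" and b: "b \<in> bilinear_maps R M N P" and u: "u \<in> carrier F"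
  shows "tensor_lift R P b (cls u) = free_lift R P (\<lambda>p. b (fst p) (snd p)) u"
proof -
  interpret P: module R P by fact
  let ?f = "free_lift R P (\<lambda>p. b (fst p) (snd p))"
  have bc: "b (fst p) (snd p) \<in> carrier P" if "p \<in> carrier M \<times> carrier N" for p
    using that bilinear_maps_closed[OF b] by auto
  have lin: "?f \<in> linear_maps R F P"
    by (rule free_lift_linear[OF P bc])
  have fe: "?f (e x y) = b x y" if "x \<in> carrier M" "y \<in> carrier N" for x y
  proof -
    have "?f (e x y) = b (fst (x, y)) (snd (x, y))"
      by (rule free_lift_basis[OF P, where X = "carrier M \<times> carrier N"]) (use bc that in auto)
    then show ?thesis by simp
  qed
  have sub: "submodule {u \<in> carrier F. ?f u = \<zero>\<^bsub>P\<^esub>} R F"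
    by (rule submodule_kernel[OF F.module_axioms P lin])
  have fminus: "?f (u \<ominus>\<^bsub>F\<^esub> v) = \<zero>\<^bsub>P\<^esub>"
    if "u \<in> carrier F" "v \<in> carrier F" "?f u = ?f v" for u v
  proof -
    have "u \<ominus>\<^bsub>F\<^esub> v = u \<oplus>\<^bsub>F\<^esub> (\<ominus>\<^bsub>R\<^esub> \<one>\<^bsub>R\<^esub>) \<odot>\<^bsub>F\<^esub> v"
      using that(2) by (simp add: a_minus_def F.smult_l_minus)
    then have "?f (u \<ominus>\<^bsub>F\<^esub> v) = ?f u \<oplus>\<^bsub>P\<^esub> (\<ominus>\<^bsub>R\<^esub> \<one>\<^bsub>R\<^esub>) \<odot>\<^bsub>P\<^esub> ?f v"
      using that(1,2) by (simp only: linear_maps_add[OF lin] linear_maps_smult[OF lin] F.smult_closed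
          M.R.a_inv_closed M.R.one_closed)
    also have "\<dots> = \<zero>\<^bsub>P\<^esub>"
      using linear_maps_closed[OF lin that(2)] by (simp add: that(3) P.smult_l_minus P.r_neg)
    finally show ?thesis .
  qed
  note bl = linear_maps_add[OF bilinear_maps_left[OF b]] linear_maps_smult[OF bilinear_maps_left[OF b]]
    linear_maps_add[OF bilinear_maps_right[OF b]] linear_maps_smult[OF bilinear_maps_right[OF b]]
  have "bilinear_relations R M N \<subseteq> {u \<in> carrier F. ?f u = \<zero>\<^bsub>P\<^esub>}"
  proof (rule subsetI)
    fix w assume w: "w \<in> bilinear_relations R M N"
    have "\<exists>u v. w = u \<ominus>\<^bsub>F\<^esub> v \<and> u \<in> carrier F \<and> v \<in> carrier F \<and> ?f u = ?f v"
      using w unfolding bilinear_relations_def Let_def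
    proof (elim UnE CollectE exE conjE, goal_cases)
      case (1 x x' y)
      have "?f (e (x \<oplus>\<^bsub>M\<^esub> x') y) = ?f (e x y \<oplus>\<^bsub>F\<^esub> e x' y)"
        using 1(2-4) by (simp add: linear_maps_add[OF lin] e_closed fe bl(1))
      then show ?case using 1 e_closed F.a_closed M.a_closed by blast
    next
      case (2 x y y')
      have "?f (e x (y \<oplus>\<^bsub>N\<^esub> y')) = ?f (e x y \<oplus>\<^bsub>F\<^esub> e x y')"
        using 2(2-4) by (simp add: linear_maps_add[OF lin] e_closed fe bl(3))
      then show ?case using 2 e_closed F.a_closed N.a_closed by blast
    next
      case (3 c x y)
      have "?f (e (c \<odot>\<^bsub>M\<^esub> x) y) = ?f (c \<odot>\<^bsub>F\<^esub> e x y)"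
        using 3(2-4) by (simp add: linear_maps_smult[OF lin] e_closed fe bl(2))
      then show ?case using 3 e_closed F.smult_closed M.smult_closed by blast
    next
      case (4 c x y)
      have "?f (e x (c \<odot>\<^bsub>N\<^esub> y)) = ?f (c \<odot>\<^bsub>F\<^esub> e x y)"
        using 4(2-4) by (simp add: linear_maps_smult[OF lin] e_closed fe bl(4))
      then show ?case using 4 e_closed F.smult_closed N.smult_closed by blast
    qed
    then show "w \<in> {u \<in> carrier F. ?f u = \<zero>\<^bsub>P\<^esub>}"
      using fminus F.minus_closed by blast
  qed
  then have I: "I \<subseteq> {u \<in> carrier F. ?f u = \<zero>\<^bsub>P\<^esub>}" by (rule I_least[OF sub])
  have "?f v = ?f u" if v: "v \<in> cls u" for v
  proof -
    obtain i where i: "i \<in> I" and vi: "v = i \<oplus>\<^bsub>F\<^esub> u" using v by (auto simp: a_r_coset_def')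
    then have "i \<in> carrier F" "?f i = \<zero>\<^bsub>P\<^esub>" using I by blast+
    then show ?thesis
      using linear_maps_closed[OF lin u] by (simp only: vi linear_maps_add[OF lin] u P.l_zero)
  qed
  then have "?f ` cls u = {?f u}"
    using I.a_rcos_self[OF u] by blast
  then show ?thesis by (simp add: tensor_lift_def free_lift_def)
qed

lemma tensor_lift_linear:
  assumes P: "module R P" and b: "b \<in> bilinear_maps R M N P"
  shows "tensor_lift R P b \<in> linear_maps R T P"
proof -
  have lin: "free_lift R P (\<lambda>p. b (fst p) (snd p)) \<in> linear_maps R F P"
    by (rule free_lift_linear[OF P]) (use bilinear_maps_closed[OF b] in auto)
  show ?thesis
    by (rule linear_mapsI)
      (auto simp: carrier_T cls_add cls_smult tensor_lift_cls[OF assms] linear_maps_closed[OF lin]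
        linear_maps_add[OF lin] linear_maps_smult[OF lin])
qed

lemma tensor_lift_pure:
  assumes P: "module R P" and b: "b \<in> bilinear_maps R M N P"
    and "x \<in> carrier M" "y \<in> carrier N"
  shows "tensor_lift R P b (x \<star> y) = b x y"
proof -
  have "free_lift R P (\<lambda>p. b (fst p) (snd p)) (e x y) = b (fst (x, y)) (snd (x, y))"
    by (rule free_lift_basis[OF P, where X = "carrier M \<times> carrier N"])
      (use bilinear_maps_closed[OF b] assms(3,4) in auto)
  then show ?thesis
    using assms(3,4) by (simp add: pure_cls tensor_lift_cls[OF P b] e_closed)
qed

lemma linear_maps_tensor_eqI:
  assumes "f \<in> linear_maps R T P" "g \<in> linear_maps R T P"
    and "\<And>x y. \<lbrakk>x \<in> carrier M; y \<in> carrier N\<rbrakk> \<Longrightarrow> f (x \<star> y) = g (x \<star> y)"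
    and "t \<in> carrier T"
  shows "f t = g t"
  using assms(4)
  by (induction rule: tensor_induct)
    (simp_all add: assms(3) linear_maps_add[OF assms(1)] linear_maps_add[OF assms(2)]
      linear_maps_smult[OF assms(1)] linear_maps_smult[OF assms(2)])

lemma tensor_lift_cong:
  assumes P: "module R P" and b: "b \<in> bilinear_maps R M N P"
    and eq: "\<And>x y. \<lbrakk>x \<in> carrier M; y \<in> carrier N\<rbrakk> \<Longrightarrow> b x y = b' x y"
    and t: "t \<in> carrier T"
  shows "tensor_lift R P b t = tensor_lift R P b' t"
proof -
  have b': "b' \<in> bilinear_maps R M N P"
    by (rule bilinear_maps_cong[OF M.module_axioms N.module_axioms b eq])
  show ?thesis
    by (rule linear_maps_tensor_eqI[OF tensor_lift_linear[OF P b] tensor_lift_linear[OF P b'] _ t])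
      (simp add: tensor_lift_pure[OF P b] tensor_lift_pure[OF P b'] eq)
qed

lemma linear_maps_tensor_lift:
  assumes P: "module R P" and Q: "module R Q" and f: "f \<in> linear_maps R P Q"
    and b: "b \<in> bilinear_maps R M N P" and t: "t \<in> carrier T"
  shows "f (tensor_lift R P b t) = tensor_lift R Q (\<lambda>x y. f (b x y)) t"
proof -
  have fb: "(\<lambda>x y. f (b x y)) \<in> bilinear_maps R M N Q"
    by (intro bilinear_mapsI linear_maps_compose[OF f])
      (auto intro: bilinear_maps_left[OF b] bilinear_maps_right[OF b])
  show ?thesis
    by (rule linear_maps_tensor_eqI[OF linear_maps_compose[OF f tensor_lift_linear[OF P b]]
          tensor_lift_linear[OF Q fb] _ t])
      (simp add: tensor_lift_pure[OF P b] tensor_lift_pure[OF Q fb])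
qed

text \<open>A lift is linear in its bilinear map, hence in every further variable on which that map depends
  linearly. This is what makes iterated lifts multilinear.\<close>

lemma tensor_lift_linear_param:
  assumes P: "module R P"
    and b: "\<And>x. x \<in> carrier L \<Longrightarrow> b x \<in> bilinear_maps R M N P"
    and lin: "\<And>y z. \<lbrakk>y \<in> carrier M; z \<in> carrier N\<rbrakk> \<Longrightarrow> (\<lambda>x. b x y z) \<in> linear_maps R L P"
    and L: "module R L"
    and t: "t \<in> carrier T"
  shows "(\<lambda>x. tensor_lift R P (b x) t) \<in> linear_maps R L P"
proof -
  interpret P: module R P by fact
  interpret L: module R L by fact
  note blin = tensor_lift_linear[OF P b]
  have pure: "tensor_lift R P (b x) (y \<star> z) = b x y z"
    if "x \<in> carrier L" "y \<in> carrier M" "z \<in> carrier N" for x y z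
    by (rule tensor_lift_pure[OF P b[OF that(1)] that(2,3)])
  show ?thesis
  proof (rule linear_mapsI)
    fix x assume x: "x \<in> carrier L"
    show "tensor_lift R P (b x) t \<in> carrier P" by (rule linear_maps_closed[OF blin[OF x] t])
    fix c assume c: "c \<in> carrier R"
    then have cx: "c \<odot>\<^bsub>L\<^esub> x \<in> carrier L" using x by simp
    show "tensor_lift R P (b (c \<odot>\<^bsub>L\<^esub> x)) t = c \<odot>\<^bsub>P\<^esub> tensor_lift R P (b x) t"
      by (rule linear_maps_tensor_eqI[OF blin[OF cx] linear_maps_smult_const[OF P blin[OF x] c] _ t])
        (simp add: pure cx x c linear_maps_smult[OF lin])
  next
    fix x x' assume x: "x \<in> carrier L" "x' \<in> carrier L"
    then have xx: "x \<oplus>\<^bsub>L\<^esub> x' \<in> carrier L" by simp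
    show "tensor_lift R P (b (x \<oplus>\<^bsub>L\<^esub> x')) t =
        tensor_lift R P (b x) t \<oplus>\<^bsub>P\<^esub> tensor_lift R P (b x') t"
      by (rule linear_maps_tensor_eqI[OF blin[OF xx]
            linear_maps_plus[OF P blin[OF x(1)] blin[OF x(2)]] _ t])
        (simp add: pure xx x linear_maps_add[OF lin])
  qed
qed

lemma tensor_lift_closed:
  "\<lbrakk>module R P; b \<in> bilinear_maps R M N P; t \<in> carrier T\<rbrakk> \<Longrightarrow> tensor_lift R P b t \<in> carrier P"
  by (blast intro: linear_maps_closed[OF tensor_lift_linear])

lemma linear_maps_pure_left:
  "\<lbrakk>g \<in> linear_maps R L M; y \<in> carrier N\<rbrakk> \<Longrightarrow> (\<lambda>x. g x \<star> y) \<in> linear_maps R L T"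
  by (rule linear_maps_compose[OF bilinear_maps_left[OF pure_tensor_bilinear]])

lemma linear_maps_pure_right:
  "\<lbrakk>x \<in> carrier M; g \<in> linear_maps R L N\<rbrakk> \<Longrightarrow> (\<lambda>y. x \<star> g y) \<in> linear_maps R L T"
  by (rule linear_maps_compose[OF bilinear_maps_right[OF pure_tensor_bilinear]])

lemma linear_maps_tensor_lift_arg:
  "\<lbrakk>module R P; b \<in> bilinear_maps R M N P; g \<in> linear_maps R L T\<rbrakk> \<Longrightarrow>
    (\<lambda>x. tensor_lift R P b (g x)) \<in> linear_maps R L P"
  by (rule linear_maps_compose[OF tensor_lift_linear])

end

text \<open>The maps between tensor products that occur here (tensor products of maps, the flip, the
  associator, the multiplication of a tensor algebra) are themselves lifts. A lift composed with
  such a map is computed by moving the outer lift inside, where it meets pure tensors.\<close>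

lemma tensor_lift_lift:
  assumes "tensor_product R M N" "tensor_product R M' N'" "module R P"
    and b: "b \<in> bilinear_maps R M' N' P"
    and c: "c \<in> bilinear_maps R M N (tensor_space R M' N')"
    and t: "t \<in> carrier (tensor_space R M N)"
  shows "tensor_lift R P b (tensor_lift R (tensor_space R M' N') c t) =
    tensor_lift R P (\<lambda>x y. tensor_lift R P b (c x y)) t"
proof -
  interpret X: tensor_product R M N by fact
  interpret Y: tensor_product R M' N' by fact
  show ?thesis
    by (rule X.linear_maps_tensor_lift[OF Y.module_T assms(3)
          Y.tensor_lift_linear[OF assms(3) b] c t])
qed

lemma tensor_map_bilinear:
  assumes "tensor_product R M' N'"
    and f: "f \<in> linear_maps R M M'" and g: "g \<in> linear_maps R N N'"
  shows "(\<lambda>x y. pure_tensor R M' N' (f x) (g y)) \<in> bilinear_maps R M N (tensor_space R M' N')"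
  by (rule bilinear_maps_precompose[OF tensor_product.pure_tensor_bilinear[OF assms(1)] f g])

lemma tensor_lift_map:
  assumes MN: "tensor_product R M N" and MN': "tensor_product R M' N'" and P: "module R P"
    and f: "f \<in> linear_maps R M M'" and g: "g \<in> linear_maps R N N'"
    and b: "b \<in> bilinear_maps R M' N' P"
    and t: "t \<in> carrier (tensor_space R M N)"
  shows "tensor_lift R P b (tensor_map R M' N' f g t) = tensor_lift R P (\<lambda>x y. b (f x) (g y)) t"
proof -
  interpret X: tensor_product R M N by fact
  interpret Y: tensor_product R M' N' by fact
  have *: "tensor_lift R P b (pure_tensor R M' N' (f x) (g y)) = b (f x) (g y)"
    if "x \<in> carrier M" "y \<in> carrier N" for x y
    by (rule Y.tensor_lift_pure[OF P b linear_maps_closed[OF f that(1)] linear_maps_closed[OF g that(2)]])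
  show ?thesis
    unfolding tensor_map_def tensor_lift_lift[OF MN MN' P b tensor_map_bilinear[OF MN' f g] t]
    by (rule X.tensor_lift_cong[OF P bilinear_maps_compose[OF Y.tensor_lift_linear[OF P b]
            tensor_map_bilinear[OF MN' f g]] * t])
qed

lemma tensor_flip_bilinear:
  assumes "tensor_product R N M"
  shows "(\<lambda>x y. pure_tensor R N M y x) \<in> bilinear_maps R M N (tensor_space R N M)"
  by (rule bilinear_maps_swap[OF tensor_product.pure_tensor_bilinear[OF assms]])

lemma tensor_lift_flip:
  assumes MN: "tensor_product R M N" and P: "module R P"
    and b: "b \<in> bilinear_maps R N M P"
    and t: "t \<in> carrier (tensor_space R M N)"
  shows "tensor_lift R P b (tensor_flip R M N t) = tensor_lift R P (\<lambda>x y. b y x) t"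
proof -
  interpret X: tensor_product R M N by fact
  have NM: "tensor_product R N M" ..
  interpret Y: tensor_product R N M by fact
  have *: "tensor_lift R P b (pure_tensor R N M y x) = b y x"
    if "x \<in> carrier M" "y \<in> carrier N" for x y
    by (rule Y.tensor_lift_pure[OF P b that(2,1)])
  show ?thesis
    unfolding tensor_flip_def tensor_lift_lift[OF MN NM P b tensor_flip_bilinear[OF NM] t]
    by (rule X.tensor_lift_cong[OF P bilinear_maps_compose[OF Y.tensor_lift_linear[OF P b]
            tensor_flip_bilinear[OF NM]] * t])
qed

lemma tensor_flip_linear:
  assumes "tensor_product R M N"
  shows "tensor_flip R M N \<in> linear_maps R (tensor_space R M N) (tensor_space R N M)"
proof -
  interpret X: tensor_product R M N by fact
  interpret Y: tensor_product R N M ..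
  show ?thesis
    unfolding tensor_flip_def
    by (rule X.tensor_lift_linear[OF Y.module_T tensor_flip_bilinear[OF Y.tensor_product_axioms]])
qed

text \<open>Both sides are finite double sums in different order. Since the sums are hidden in the lifts, both
  sides are compared as linear maps in the tensor \<open>s\<close>, where pure tensors suffice.\<close>

lemma tensor_lift_swap:
  assumes MN: "tensor_product R M N" and MN': "tensor_product R M' N'" and P: "module R P"
    and inner: "\<And>x y. \<lbrakk>x \<in> carrier M; y \<in> carrier N\<rbrakk> \<Longrightarrow> b x y \<in> bilinear_maps R M' N' P"
    and outer: "\<And>u v. \<lbrakk>u \<in> carrier M'; v \<in> carrier N'\<rbrakk> \<Longrightarrow>
      (\<lambda>x y. b x y u v) \<in> bilinear_maps R M N P"
    and s: "s \<in> carrier (tensor_space R M' N')" and t: "t \<in> carrier (tensor_space R M N)"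
  shows "tensor_lift R P (\<lambda>x y. tensor_lift R P (b x y) s) t =
    tensor_lift R P (\<lambda>u v. tensor_lift R P (\<lambda>x y. b x y u v) t) s"
proof -
  interpret X: tensor_product R M N by fact
  interpret Y: tensor_product R M' N' by fact
  have 1: "(\<lambda>x y. tensor_lift R P (b x y) s) \<in> bilinear_maps R M N P" if "s \<in> carrier Y.T" for s
    by (intro bilinear_mapsI Y.tensor_lift_linear_param P inner that X.M.module_axioms X.N.module_axioms)
      (auto intro: bilinear_maps_left[OF outer] bilinear_maps_right[OF outer])
  have 2: "(\<lambda>u v. tensor_lift R P (\<lambda>x y. b x y u v) t) \<in> bilinear_maps R M' N' P"
    if "t \<in> carrier X.T" for t
    by (intro bilinear_mapsI X.tensor_lift_linear_param P outer that Y.M.module_axioms Y.N.module_axioms)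
      (auto intro: bilinear_maps_left[OF inner] bilinear_maps_right[OF inner])
  have 3: "(\<lambda>s. tensor_lift R P (\<lambda>x y. tensor_lift R P (b x y) s) t) \<in> linear_maps R Y.T P"
    by (intro X.tensor_lift_linear_param 1 P t Y.module_T Y.tensor_lift_linear inner)
  show ?thesis
  proof (rule Y.linear_maps_tensor_eqI[OF 3 Y.tensor_lift_linear[OF P 2[OF t]] _ s])
    fix u v assume uv: "u \<in> carrier M'" "v \<in> carrier N'"
    have "tensor_lift R P (\<lambda>x y. tensor_lift R P (b x y) (pure_tensor R M' N' u v)) t =
        tensor_lift R P (\<lambda>x y. b x y u v) t"
      by (rule X.tensor_lift_cong[OF P 1[OF Y.pure_tensor_closed[OF uv]] _ t])
        (rule Y.tensor_lift_pure[OF P inner uv])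
    also have "\<dots> = tensor_lift R P (\<lambda>u v. tensor_lift R P (\<lambda>x y. b x y u v) t) (pure_tensor R M' N' u v)"
      by (rule Y.tensor_lift_pure[OF P 2[OF t] uv, symmetric])
    finally show "tensor_lift R P (\<lambda>x y. tensor_lift R P (b x y) (pure_tensor R M' N' u v)) t = \<dots>" .
  qed
qed

text \<open>The associator is understood through the trilinear maps \<open>\<phi>\<close> that can be evaluated on its source
  and target: it changes the bracketing of the evaluation and nothing else.\<close>

lemma tensor_lift_assoc:
  assumes "module R M" "module R N" "module R Q" and P: "module R P"
    and \<phi>: "\<And>x. x \<in> carrier M \<Longrightarrow> \<phi> x \<in> bilinear_maps R N Q P"
    and \<phi>': "\<And>y z. \<lbrakk>y \<in> carrier N; z \<in> carrier Q\<rbrakk> \<Longrightarrow> (\<lambda>x. \<phi> x y z) \<in> linear_maps R M P"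
    and t: "t \<in> carrier (tensor_space R (tensor_space R M N) Q)"
  shows "tensor_lift R P (\<lambda>x. tensor_lift R P (\<phi> x)) (tensor_assoc R M N Q t) =
    tensor_lift R P (\<lambda>s z. tensor_lift R P (\<lambda>x y. \<phi> x y z) s) t"
proof -
  interpret M: module R M by fact
  interpret N: module R N by fact
  interpret Q: module R Q by fact
  interpret MN: tensor_product R M N ..
  interpret NQ: tensor_product R N Q ..
  have L: "tensor_product R MN.T Q"
    by (intro tensor_product.intro MN.module_T Q.module_axioms)
  have R: "tensor_product R M NQ.T"
    by (intro tensor_product.intro NQ.module_T M.module_axioms)
  interpret L: tensor_product R MN.T Q by (rule L)
  interpret R: tensor_product R M NQ.T by (rule R)
  have B: "(\<lambda>x. tensor_lift R P (\<phi> x)) \<in> bilinear_maps R M NQ.T P"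
    by (intro bilinear_mapsI NQ.tensor_lift_linear NQ.tensor_lift_linear_param P \<phi> \<phi>' M.module_axioms)
  define \<alpha> where "\<alpha> z x y = pure_tensor R M NQ.T x (pure_tensor R N Q y z)" for z x y
  have \<alpha>: "\<alpha> z \<in> bilinear_maps R M N R.T" if "z \<in> carrier Q" for z
    unfolding \<alpha>_def using that
    by (intro bilinear_mapsI R.linear_maps_pure_left R.linear_maps_pure_right NQ.linear_maps_pure_left
        linear_maps_id NQ.pure_tensor_closed)
  have \<alpha>': "(\<lambda>z. \<alpha> z x y) \<in> linear_maps R Q R.T" if "x \<in> carrier M" "y \<in> carrier N" for x y
    unfolding \<alpha>_def using that
    by (intro R.linear_maps_pure_right NQ.linear_maps_pure_right linear_maps_id)
  have \<beta>: "(\<lambda>s z. tensor_lift R R.T (\<alpha> z) s) \<in> bilinear_maps R MN.T Q R.T"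
    by (intro bilinear_mapsI MN.tensor_lift_linear MN.tensor_lift_linear_param R.module_T \<alpha> \<alpha>'
        Q.module_axioms)
  have assoc: "tensor_assoc R M N Q t = tensor_lift R R.T (\<lambda>s z. tensor_lift R R.T (\<alpha> z) s) t"
    unfolding tensor_assoc_def Let_def \<alpha>_def ..
  have 1: "tensor_lift R P (\<lambda>x. tensor_lift R P (\<phi> x)) (\<alpha> z x y) = \<phi> x y z"
    if "x \<in> carrier M" "y \<in> carrier N" "z \<in> carrier Q" for x y z
    unfolding \<alpha>_def using that
    by (simp add: R.tensor_lift_pure[OF P B] NQ.tensor_lift_pure[OF P \<phi>] NQ.pure_tensor_closed)
  have 2: "tensor_lift R P (\<lambda>x. tensor_lift R P (\<phi> x)) (tensor_lift R R.T (\<alpha> z) s) =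
      tensor_lift R P (\<lambda>x y. \<phi> x y z) s" if "s \<in> carrier MN.T" "z \<in> carrier Q" for s z
    unfolding tensor_lift_lift[OF MN.tensor_product_axioms R P B \<alpha>[OF that(2)] that(1)]
    by (rule MN.tensor_lift_cong[OF P
          bilinear_maps_compose[OF R.tensor_lift_linear[OF P B] \<alpha>[OF that(2)]] _ that(1)])
      (rule 1[OF _ _ that(2)])
  show ?thesis
    unfolding assoc tensor_lift_lift[OF L R P B \<beta> t]
    by (rule L.tensor_lift_cong[OF P bilinear_maps_compose[OF R.tensor_lift_linear[OF P B] \<beta>] 2 t])
qed

section \<open>Associative algebras\<close>

text \<open>Convolution takes values in algebras that need not be commutative, such as a Hopf algebra or its
  tensor square.\<close>

locale assoc_algebra = module R A + A: ring A
  for R :: "('k, 'r) ring_scheme" and A :: "('k, 'a, 'm) module_scheme" +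
  assumes smult_mult_left:
      "\<lbrakk>c \<in> carrier R; x \<in> carrier A; y \<in> carrier A\<rbrakk> \<Longrightarrow>
        (c \<odot>\<^bsub>A\<^esub> x) \<otimes>\<^bsub>A\<^esub> y = c \<odot>\<^bsub>A\<^esub> (x \<otimes>\<^bsub>A\<^esub> y)"
    and smult_mult_right:
      "\<lbrakk>c \<in> carrier R; x \<in> carrier A; y \<in> carrier A\<rbrakk> \<Longrightarrow>
        x \<otimes>\<^bsub>A\<^esub> (c \<odot>\<^bsub>A\<^esub> y) = c \<odot>\<^bsub>A\<^esub> (x \<otimes>\<^bsub>A\<^esub> y)"
begin

lemma mult_bilinear: "mult A \<in> bilinear_maps R A A A"
  by (intro bilinear_mapsI linear_mapsI)
    (simp_all add: A.r_distr A.l_distr smult_mult_left smult_mult_right)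

lemma linear_maps_mult_left:
  "\<lbrakk>g \<in> linear_maps R L A; a \<in> carrier A\<rbrakk> \<Longrightarrow> (\<lambda>x. g x \<otimes>\<^bsub>A\<^esub> a) \<in> linear_maps R L A"
  by (rule linear_maps_compose[OF bilinear_maps_left[OF mult_bilinear]])

lemma linear_maps_mult_right:
  "\<lbrakk>a \<in> carrier A; g \<in> linear_maps R L A\<rbrakk> \<Longrightarrow> (\<lambda>x. a \<otimes>\<^bsub>A\<^esub> g x) \<in> linear_maps R L A"
  by (rule linear_maps_compose[OF bilinear_maps_right[OF mult_bilinear]])

end

lemma tensor_algebra_simps [simp]:
  "carrier (tensor_algebra R A B) = carrier (tensor_space R A B)"
  "add (tensor_algebra R A B) = add (tensor_space R A B)"
  "zero (tensor_algebra R A B) = zero (tensor_space R A B)"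
  "smult (tensor_algebra R A B) = smult (tensor_space R A B)"
  "one (tensor_algebra R A B) = pure_tensor R A B \<one>\<^bsub>A\<^esub> \<one>\<^bsub>B\<^esub>"
  by (simp_all add: tensor_algebra_def Let_def)

lemma tensor_lift_tensor_algebra:
  "tensor_lift R (tensor_algebra R A B) = tensor_lift R (tensor_space R A B)"
  by (simp add: tensor_lift_def fun_eq_iff finsum_def)

lemma linear_maps_tensor_algebra:
  "linear_maps R L (tensor_algebra R A B) = linear_maps R L (tensor_space R A B)"
  by (simp add: linear_maps_def)

lemma bilinear_maps_tensor_algebra:
  "bilinear_maps R M N (tensor_algebra R A B) = bilinear_maps R M N (tensor_space R A B)"
  by (simp add: bilinear_maps_def linear_maps_tensor_algebra)

locale tensor_product_algebra = A: assoc_algebra R A + B: assoc_algebra R B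
  for R :: "('k, 'r) ring_scheme" and A :: "('k, 'a, 'm) module_scheme"
    and B :: "('k, 'b, 'n) module_scheme"
begin

sublocale tensor_product R A B ..

interpretation T: module R "tensor_space R A B" by (rule module_T)

abbreviation "AB \<equiv> tensor_algebra R A B"
notation tensor (infixl \<open>\<star>\<close> 70)

lemma tensor_mult_def:
  "s \<otimes>\<^bsub>AB\<^esub> t = tensor_lift R T (\<lambda>a b. tensor_lift R T (\<lambda>c d. (a \<otimes>\<^bsub>A\<^esub> c) \<star> (b \<otimes>\<^bsub>B\<^esub> d)) t) s"
  by (simp add: tensor_algebra_def Let_def)

lemma tensor_mult_inner:
  assumes "a \<in> carrier A" "b \<in> carrier B"
  shows "(\<lambda>c d. (a \<otimes>\<^bsub>A\<^esub> c) \<star> (b \<otimes>\<^bsub>B\<^esub> d)) \<in> bilinear_maps R A B T"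
  using assms
  by (intro bilinear_mapsI linear_maps_pure_left linear_maps_pure_right A.linear_maps_mult_right
      B.linear_maps_mult_right linear_maps_id) auto

lemma tensor_mult_outer:
  assumes "t \<in> carrier T"
  shows "(\<lambda>a b. tensor_lift R T (\<lambda>c d. (a \<otimes>\<^bsub>A\<^esub> c) \<star> (b \<otimes>\<^bsub>B\<^esub> d)) t) \<in> bilinear_maps R A B T"
  using assms
  by (intro bilinear_mapsI tensor_lift_linear_param module_T tensor_mult_inner
      linear_maps_pure_left linear_maps_pure_right A.linear_maps_mult_left
      B.linear_maps_mult_left linear_maps_id A.module_axioms B.module_axioms) auto

lemma tensor_mult_pure:
  assumes "a \<in> carrier A" "b \<in> carrier B" "c \<in> carrier A" "d \<in> carrier B"
  shows "(a \<star> b) \<otimes>\<^bsub>AB\<^esub> (c \<star> d) = (a \<otimes>\<^bsub>A\<^esub> c) \<star> (b \<otimes>\<^bsub>B\<^esub> d)"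
  unfolding tensor_mult_def
  using assms
  by (simp add: tensor_lift_pure[OF module_T tensor_mult_outer] pure_tensor_closed
      tensor_lift_pure[OF module_T tensor_mult_inner])

lemma tensor_mult_bilinear: "mult AB \<in> bilinear_maps R T T T"
proof (intro bilinear_mapsI)
  fix t assume t: "t \<in> carrier T"
  show "(\<lambda>s. s \<otimes>\<^bsub>AB\<^esub> t) \<in> linear_maps R T T"
    unfolding tensor_mult_def
    by (rule tensor_lift_linear[OF module_T tensor_mult_outer[OF t]])
  show "(\<lambda>s. t \<otimes>\<^bsub>AB\<^esub> s) \<in> linear_maps R T T"
    unfolding tensor_mult_def
    by (intro tensor_lift_linear_param module_T tensor_mult_outer tensor_lift_linear
        tensor_mult_inner t)
qed

text \<open>Both sides are linear in each factor, so the three factors are reduced to pure tensors one after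
  the other.\<close>

lemma tensor_mult_assoc:
  assumes s: "s \<in> carrier T" and t: "t \<in> carrier T" and u: "u \<in> carrier T"
  shows "(s \<otimes>\<^bsub>AB\<^esub> t) \<otimes>\<^bsub>AB\<^esub> u = s \<otimes>\<^bsub>AB\<^esub> (t \<otimes>\<^bsub>AB\<^esub> u)"
proof -
  note L = bilinear_maps_left[OF tensor_mult_bilinear]
  note R = bilinear_maps_right[OF tensor_mult_bilinear]
  note closed = bilinear_maps_closed[OF tensor_mult_bilinear]
  have 1: "((a \<star> b) \<otimes>\<^bsub>AB\<^esub> (c \<star> d)) \<otimes>\<^bsub>AB\<^esub> u = (a \<star> b) \<otimes>\<^bsub>AB\<^esub> ((c \<star> d) \<otimes>\<^bsub>AB\<^esub> u)"
    if "a \<in> carrier A" "b \<in> carrier B" "c \<in> carrier A" "d \<in> carrier B" for a b c d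
    using that
    by (intro linear_maps_tensor_eqI[OF R linear_maps_compose[OF R R] _ u])
      (simp_all add: closed pure_tensor_closed tensor_mult_pure A.A.m_assoc B.A.m_assoc)
  have 2: "((a \<star> b) \<otimes>\<^bsub>AB\<^esub> t) \<otimes>\<^bsub>AB\<^esub> u = (a \<star> b) \<otimes>\<^bsub>AB\<^esub> (t \<otimes>\<^bsub>AB\<^esub> u)"
    if "a \<in> carrier A" "b \<in> carrier B" for a b
    by (rule linear_maps_tensor_eqI[OF linear_maps_compose[OF L R] linear_maps_compose[OF R L] _ t])
      (simp_all add: that u pure_tensor_closed 1)
  show ?thesis
    by (rule linear_maps_tensor_eqI[OF linear_maps_compose[OF L L] L _ s])
      (simp_all add: t u closed 2)
qed

lemma assoc_algebra_tensor_algebra: "assoc_algebra R AB"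
proof -
  note L = bilinear_maps_left[OF tensor_mult_bilinear]
  note R = bilinear_maps_right[OF tensor_mult_bilinear]
  note closed = bilinear_maps_closed[OF tensor_mult_bilinear]
  have one: "\<one>\<^bsub>A\<^esub> \<star> \<one>\<^bsub>B\<^esub> \<in> carrier T" by (simp add: pure_tensor_closed)
  have l_one: "(\<one>\<^bsub>A\<^esub> \<star> \<one>\<^bsub>B\<^esub>) \<otimes>\<^bsub>AB\<^esub> t = t" if "t \<in> carrier T" for t
    by (rule linear_maps_tensor_eqI[OF R[OF one] linear_maps_id _ that]) (simp add: tensor_mult_pure)
  have r_one: "t \<otimes>\<^bsub>AB\<^esub> (\<one>\<^bsub>A\<^esub> \<star> \<one>\<^bsub>B\<^esub>) = t" if "t \<in> carrier T" for t
    by (rule linear_maps_tensor_eqI[OF L[OF one] linear_maps_id _ that]) (simp add: tensor_mult_pure)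
  have group: "abelian_group AB"
  proof (rule abelian_groupI)
    fix x assume "x \<in> carrier AB"
    then show "\<exists>y\<in>carrier AB. y \<oplus>\<^bsub>AB\<^esub> x = \<zero>\<^bsub>AB\<^esub>"
      by (intro bexI[of _ "\<ominus>\<^bsub>T\<^esub> x"]) (simp_all add: T.l_neg)
  qed (simp_all add: T.a_ac)
  have monoid: "monoid AB"
    by (rule monoidI) (simp_all add: closed one l_one r_one tensor_mult_assoc)
  have ring: "ring AB"
    by (rule ringI[OF group monoid]) (simp_all add: linear_maps_add[OF L] linear_maps_add[OF R])
  have mod: "module R AB"
    by (rule moduleI[OF A.R.cring_axioms group])
      (simp_all add: T.smult_l_distr T.smult_r_distr T.smult_assoc1)
  show ?thesis
    by (intro assoc_algebra.intro assoc_algebra_axioms.intro mod ring)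
      (simp_all add: linear_maps_smult[OF L] linear_maps_smult[OF R])
qed

end

section \<open>Sweedler calculus\<close>

text \<open>The Sweedler sum \<open>\<Sum> b x\<^sub>1 x\<^sub>2\<close> over \<open>\<Delta> x = \<Sum> x\<^sub>1 \<otimes> x\<^sub>2\<close>, meaningful for bilinear \<open>b\<close>.\<close>

definition sweedler ::
    "('k, 'r) ring_scheme \<Rightarrow> ('k, 'h, 'z) hopf_scheme \<Rightarrow> ('k, 'c, 'p) module_scheme \<Rightarrow>
      ('h \<Rightarrow> 'h \<Rightarrow> 'c) \<Rightarrow> 'h \<Rightarrow> 'c"
  where "sweedler R H P b x = tensor_lift R P b (comult H x)"

lemma sweedler_tensor_algebra:
  "sweedler R H (tensor_algebra R A B) = sweedler R H (tensor_space R A B)"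
  by (simp add: sweedler_def fun_eq_iff tensor_lift_tensor_algebra)

context hopf_algebra
begin

sublocale assoc_algebra R H
  by (intro assoc_algebra.intro assoc_algebra_axioms.intro module_axioms H.ring_axioms
      smult_mult_left smult_mult_right)

sublocale HH: tensor_product_algebra R H H ..

abbreviation "S \<equiv> antipode H"
abbreviation "\<epsilon> \<equiv> counit H"
abbreviation "\<Delta> \<equiv> comult H"

lemma counit_closed [simp]: "x \<in> carrier H \<Longrightarrow> \<epsilon> x \<in> carrier R"
  using linear_maps_closed[OF counit_linear] by (simp add: ground_def)

lemma antipode_closed [simp]: "x \<in> carrier H \<Longrightarrow> S x \<in> carrier H"
  by (rule linear_maps_closed[OF antipode_linear])

lemma comult_closed: "x \<in> carrier H \<Longrightarrow> \<Delta> x \<in> carrier (tensor_space R H H)"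
  by (rule linear_maps_closed[OF comult_linear])

lemma sweedler_linear:
  "\<lbrakk>module R P; b \<in> bilinear_maps R H H P; g \<in> linear_maps R L H\<rbrakk> \<Longrightarrow>
    (\<lambda>x. sweedler R H P b (g x)) \<in> linear_maps R L P"
  unfolding sweedler_def
  by (intro HH.linear_maps_tensor_lift_arg linear_maps_compose[OF comult_linear])

lemma sweedler_closed:
  "\<lbrakk>module R P; b \<in> bilinear_maps R H H P; x \<in> carrier H\<rbrakk> \<Longrightarrow> sweedler R H P b x \<in> carrier P"
  unfolding sweedler_def by (intro HH.tensor_lift_closed comult_closed)

lemma sweedler_linear_param:
  "\<lbrakk>module R P; \<And>x. x \<in> carrier L \<Longrightarrow> b x \<in> bilinear_maps R H H P;
    \<And>y z. \<lbrakk>y \<in> carrier H; z \<in> carrier H\<rbrakk> \<Longrightarrow> (\<lambda>x. b x y z) \<in> linear_maps R L P;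
    module R L; t \<in> carrier H\<rbrakk> \<Longrightarrow> (\<lambda>x. sweedler R H P (b x) t) \<in> linear_maps R L P"
  unfolding sweedler_def by (intro HH.tensor_lift_linear_param comult_closed)

lemma sweedler_cong:
  assumes "module R P" "b \<in> bilinear_maps R H H P"
    and "\<And>y z. \<lbrakk>y \<in> carrier H; z \<in> carrier H\<rbrakk> \<Longrightarrow> b y z = b' y z" and "x \<in> carrier H"
  shows "sweedler R H P b x = sweedler R H P b' x"
  unfolding sweedler_def by (rule HH.tensor_lift_cong[OF assms(1-3) comult_closed[OF assms(4)]])

lemma linear_maps_sweedler:
  assumes "module R P" "module R Q" "f \<in> linear_maps R P Q" "b \<in> bilinear_maps R H H P"
    and "x \<in> carrier H"
  shows "f (sweedler R H P b x) = sweedler R H Q (\<lambda>y z. f (b y z)) x"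
  unfolding sweedler_def
  by (rule HH.linear_maps_tensor_lift[OF assms(1-4) comult_closed[OF assms(5)]])

text \<open>Coassociativity in the form in which calculations use it: a sum \<open>\<Sum> \<phi> x\<^sub>1 x\<^sub>2 x\<^sub>3\<close> may be formed by
  splitting the left or the right component a second time. It follows by evaluating the
  coassociativity law in \<open>H \<otimes> (H \<otimes> H)\<close> on the trilinear map \<open>\<phi>\<close>.\<close>

lemma sweedler_coassoc:
  assumes P: "module R P"
    and \<phi>: "\<And>x. x \<in> carrier H \<Longrightarrow> \<phi> x \<in> bilinear_maps R H H P"
    and \<phi>': "\<And>y z. \<lbrakk>y \<in> carrier H; z \<in> carrier H\<rbrakk> \<Longrightarrow> (\<lambda>x. \<phi> x y z) \<in> linear_maps R H P"
    and x: "x \<in> carrier H"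
  shows "sweedler R H P (\<lambda>s z. sweedler R H P (\<lambda>x y. \<phi> x y z) s) x =
    sweedler R H P (\<lambda>x. sweedler R H P (\<phi> x)) x"
proof -
  let ?HH = "tensor_space R H H"
  have L: "tensor_product R ?HH H"
    by (intro tensor_product.intro HH.module_T module_axioms)
  have R: "tensor_product R H ?HH"
    by (intro tensor_product.intro HH.module_T module_axioms)
  interpret L: tensor_product R ?HH H by (rule L)
  interpret R: tensor_product R H ?HH by (rule R)
  note HHt = HH.tensor_product_axioms
  have B: "(\<lambda>x. tensor_lift R P (\<phi> x)) \<in> bilinear_maps R H ?HH P"
    by (intro bilinear_mapsI HH.tensor_lift_linear HH.tensor_lift_linear_param P \<phi> \<phi>' module_axioms)
  have \<phi>'': "(\<lambda>x y. \<phi> x y z) \<in> bilinear_maps R H H P" if "z \<in> carrier H" for z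
    using that by (intro bilinear_mapsI \<phi>' bilinear_maps_left[OF \<phi>])
  have C: "(\<lambda>s z. tensor_lift R P (\<lambda>x y. \<phi> x y z) s) \<in> bilinear_maps R ?HH H P"
    by (intro bilinear_mapsI HH.tensor_lift_linear HH.tensor_lift_linear_param P \<phi>''
        bilinear_maps_right[OF \<phi>] module_axioms)
  have D: "tensor_map R ?HH H \<Delta> (\<lambda>y. y) (\<Delta> x) \<in> carrier (tensor_space R ?HH H)"
    unfolding tensor_map_def
    by (intro HH.tensor_lift_closed L.module_T comult_closed x
        tensor_map_bilinear L comult_linear linear_maps_id)
  have "sweedler R H P (\<lambda>s z. sweedler R H P (\<lambda>x y. \<phi> x y z) s) x =
      tensor_lift R P (\<lambda>s z. tensor_lift R P (\<lambda>x y. \<phi> x y z) s) (tensor_map R ?HH H \<Delta> (\<lambda>y. y) (\<Delta> x))"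
    unfolding sweedler_def
    by (rule tensor_lift_map[OF HHt L P comult_linear linear_maps_id C comult_closed[OF x], symmetric])
  also have "\<dots> = tensor_lift R P (\<lambda>x. tensor_lift R P (\<phi> x))
      (tensor_assoc R H H H (tensor_map R ?HH H \<Delta> (\<lambda>y. y) (\<Delta> x)))"
    by (rule tensor_lift_assoc[OF module_axioms module_axioms module_axioms P \<phi> \<phi>' D, symmetric])
  also have "\<dots> = tensor_lift R P (\<lambda>x. tensor_lift R P (\<phi> x)) (tensor_map R H ?HH (\<lambda>y. y) \<Delta> (\<Delta> x))"
    by (simp only: coassoc[OF x])
  also have "\<dots> = sweedler R H P (\<lambda>x. sweedler R H P (\<phi> x)) x"
    unfolding sweedler_def
    by (rule tensor_lift_map[OF HHt R P linear_maps_id comult_linear B comult_closed[OF x]])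
  finally show ?thesis .
qed

lemma sweedler_swap:
  assumes "module R P"
    and "\<And>a b. \<lbrakk>a \<in> carrier H; b \<in> carrier H\<rbrakk> \<Longrightarrow> \<phi> a b \<in> bilinear_maps R H H P"
    and "\<And>c d. \<lbrakk>c \<in> carrier H; d \<in> carrier H\<rbrakk> \<Longrightarrow> (\<lambda>a b. \<phi> a b c d) \<in> bilinear_maps R H H P"
    and "x \<in> carrier H" "y \<in> carrier H"
  shows "sweedler R H P (\<lambda>a b. sweedler R H P (\<phi> a b) y) x =
    sweedler R H P (\<lambda>c d. sweedler R H P (\<lambda>a b. \<phi> a b c d) x) y"
  unfolding sweedler_def
  by (rule tensor_lift_swap[OF HH.tensor_product_axioms HH.tensor_product_axioms assms(1-3)
        comult_closed comult_closed]) (assumption | rule assms(4,5))+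

lemma sweedler_counit_left:
  assumes P: "module R P" and f: "f \<in> linear_maps R H P" and x: "x \<in> carrier H"
  shows "sweedler R H P (\<lambda>y z. \<epsilon> y \<odot>\<^bsub>P\<^esub> f z) x = f x"
proof -
  have b: "(\<lambda>y z. \<epsilon> y \<odot>\<^bsub>H\<^esub> z) \<in> bilinear_maps R H H H"
    by (intro bilinear_mapsI linear_maps_smult_const linear_maps_scalar module_axioms counit_linear
        linear_maps_id counit_closed)
  have "f x = f (sweedler R H H (\<lambda>y z. \<epsilon> y \<odot>\<^bsub>H\<^esub> z) x)"
    using counit_left[OF x] by (simp add: sweedler_def)
  also have "\<dots> = sweedler R H P (\<lambda>y z. f (\<epsilon> y \<odot>\<^bsub>H\<^esub> z)) x"
    by (rule linear_maps_sweedler[OF module_axioms P f b x])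
  also have "\<dots> = sweedler R H P (\<lambda>y z. \<epsilon> y \<odot>\<^bsub>P\<^esub> f z) x"
    by (rule sweedler_cong[OF P bilinear_maps_compose[OF f b] _ x])
      (simp add: linear_maps_smult[OF f])
  finally show ?thesis ..
qed

lemma sweedler_counit_right:
  assumes P: "module R P" and f: "f \<in> linear_maps R H P" and x: "x \<in> carrier H"
  shows "sweedler R H P (\<lambda>y z. \<epsilon> z \<odot>\<^bsub>P\<^esub> f y) x = f x"
proof -
  have b: "(\<lambda>y z. \<epsilon> z \<odot>\<^bsub>H\<^esub> y) \<in> bilinear_maps R H H H"
    by (intro bilinear_mapsI linear_maps_smult_const linear_maps_scalar module_axioms counit_linear
        linear_maps_id counit_closed)
  have "f x = f (sweedler R H H (\<lambda>y z. \<epsilon> z \<odot>\<^bsub>H\<^esub> y) x)"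
    using counit_right[OF x] by (simp add: sweedler_def)
  also have "\<dots> = sweedler R H P (\<lambda>y z. f (\<epsilon> z \<odot>\<^bsub>H\<^esub> y)) x"
    by (rule linear_maps_sweedler[OF module_axioms P f b x])
  also have "\<dots> = sweedler R H P (\<lambda>y z. \<epsilon> z \<odot>\<^bsub>P\<^esub> f y) x"
    by (rule sweedler_cong[OF P bilinear_maps_compose[OF f b] _ x])
      (simp add: linear_maps_smult[OF f])
  finally show ?thesis ..
qed

lemma sweedler_antipode_left:
  "x \<in> carrier H \<Longrightarrow> sweedler R H H (\<lambda>y z. S y \<otimes>\<^bsub>H\<^esub> z) x = \<epsilon> x \<odot>\<^bsub>H\<^esub> \<one>\<^bsub>H\<^esub>"
  by (simp add: sweedler_def antipode_left)

lemma sweedler_antipode_right: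
  "x \<in> carrier H \<Longrightarrow> sweedler R H H (\<lambda>y z. y \<otimes>\<^bsub>H\<^esub> S z) x = \<epsilon> x \<odot>\<^bsub>H\<^esub> \<one>\<^bsub>H\<^esub>"
  by (simp add: sweedler_def antipode_right)

lemma sweedler_one:
  assumes "module R P" "b \<in> bilinear_maps R H H P"
  shows "sweedler R H P b \<one>\<^bsub>H\<^esub> = b \<one>\<^bsub>H\<^esub> \<one>\<^bsub>H\<^esub>"
  using ring_hom_one[OF comult_ring_hom]
  by (simp add: sweedler_def HH.tensor_lift_pure[OF assms])

text \<open>The comultiplication is a map of algebras, so the components of a product are the products of the
  components: \<open>\<Sum> b (xy)\<^sub>1 (xy)\<^sub>2 = \<Sum> \<Sum> b (x\<^sub>1 y\<^sub>1) (x\<^sub>2 y\<^sub>2)\<close>.\<close>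

lemma sweedler_mult:
  assumes P: "module R P" and b: "b \<in> bilinear_maps R H H P"
    and x: "x \<in> carrier H" and y: "y \<in> carrier H"
  shows "sweedler R H P b (x \<otimes>\<^bsub>H\<^esub> y) =
    sweedler R H P (\<lambda>u v. sweedler R H P (\<lambda>c d. b (u \<otimes>\<^bsub>H\<^esub> c) (v \<otimes>\<^bsub>H\<^esub> d)) y) x"
proof -
  note HHt = HH.tensor_product_axioms
  note lin = HH.tensor_lift_linear[OF P b]
  have "sweedler R H P b (x \<otimes>\<^bsub>H\<^esub> y) = tensor_lift R P b (\<Delta> x \<otimes>\<^bsub>tensor_algebra R H H\<^esub> \<Delta> y)"
    by (simp add: sweedler_def ring_hom_mult[OF comult_ring_hom x y])
  also have "\<dots> = tensor_lift R P (\<lambda>u v. tensor_lift R P b (tensor_lift R (tensor_space R H H)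
      (\<lambda>c d. pure_tensor R H H (u \<otimes>\<^bsub>H\<^esub> c) (v \<otimes>\<^bsub>H\<^esub> d)) (\<Delta> y))) (\<Delta> x)"
    unfolding HH.tensor_mult_def
    by (rule tensor_lift_lift[OF HHt HHt P b HH.tensor_mult_outer[OF comult_closed[OF y]] comult_closed[OF x]])
  also have "\<dots> = tensor_lift R P (\<lambda>u v. tensor_lift R P (\<lambda>c d. b (u \<otimes>\<^bsub>H\<^esub> c) (v \<otimes>\<^bsub>H\<^esub> d)) (\<Delta> y)) (\<Delta> x)"
  proof (rule HH.tensor_lift_cong[OF P bilinear_maps_compose[OF lin
          HH.tensor_mult_outer[OF comult_closed[OF y]]] _ comult_closed[OF x]])
    fix u v assume uv: "u \<in> carrier H" "v \<in> carrier H"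
    show "tensor_lift R P b (tensor_lift R (tensor_space R H H)
        (\<lambda>c d. pure_tensor R H H (u \<otimes>\<^bsub>H\<^esub> c) (v \<otimes>\<^bsub>H\<^esub> d)) (\<Delta> y)) =
      tensor_lift R P (\<lambda>c d. b (u \<otimes>\<^bsub>H\<^esub> c) (v \<otimes>\<^bsub>H\<^esub> d)) (\<Delta> y)"
      unfolding tensor_lift_lift[OF HHt HHt P b HH.tensor_mult_inner[OF uv] comult_closed[OF y]]
      by (rule HH.tensor_lift_cong[OF P bilinear_maps_compose[OF lin HH.tensor_mult_inner[OF uv]] _
            comult_closed[OF y]])
        (simp add: HH.tensor_lift_pure[OF P b] uv)
  qed
  finally show ?thesis unfolding sweedler_def .
qed

text \<open>Used backwards, each rule peels off the outermost operation of an expression in which one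
  variable occurs linearly. Repeated application reduces bilinearity of the expressions below to
  membership of their variables in the carrier.\<close>

lemmas multilinear = bilinear_mapsI linear_maps_id linear_maps_mult_left linear_maps_mult_right
  sweedler_linear_param sweedler_linear linear_maps_compose[OF antipode_linear]
  HH.linear_maps_pure_left HH.linear_maps_pure_right
  module_axioms HH.module_T H.m_closed antipode_closed HH.pure_tensor_closed sweedler_closed

section \<open>Convolution\<close>

definition convolution where
  "convolution A f g x = sweedler R H A (\<lambda>y z. f y \<otimes>\<^bsub>A\<^esub> g z) x"

lemma convolution_bilinear:
  assumes "assoc_algebra R A" "f \<in> linear_maps R H A" "g \<in> linear_maps R H A"
  shows "(\<lambda>y z. f y \<otimes>\<^bsub>A\<^esub> g z) \<in> bilinear_maps R H H A"
  by (rule bilinear_maps_precompose[OF assoc_algebra.mult_bilinear[OF assms(1)] assms(2,3)])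

lemma convolution_linear:
  assumes A: "assoc_algebra R A" and f: "f \<in> linear_maps R H A" and g: "g \<in> linear_maps R H A"
  shows "convolution A f g \<in> linear_maps R H A"
proof -
  interpret A: assoc_algebra R A by fact
  show ?thesis
    unfolding convolution_def
    by (intro sweedler_linear A.module_axioms convolution_bilinear assms linear_maps_id)
qed

lemma convolution_cong:
  assumes A: "assoc_algebra R A" and f: "f \<in> linear_maps R H A" and g: "g \<in> linear_maps R H A"
    and "\<And>y. y \<in> carrier H \<Longrightarrow> f y = f' y" "\<And>y. y \<in> carrier H \<Longrightarrow> g y = g' y"
    and x: "x \<in> carrier H"
  shows "convolution A f g x = convolution A f' g' x"
proof -
  interpret A: assoc_algebra R A by fact
  show ?thesis
    unfolding convolution_def
    by (rule sweedler_cong[OF A.module_axioms convolution_bilinear[OF A f g] _ x]) (simp only: assms)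
qed

text \<open>Both sides are the sum of \<open>f x\<^sub>1 g x\<^sub>2 h x\<^sub>3\<close>; coassociativity matches the splittings and
  associativity of \<open>A\<close> the brackets.\<close>

lemma convolution_assoc:
  assumes A: "assoc_algebra R A"
    and f: "f \<in> linear_maps R H A" and g: "g \<in> linear_maps R H A" and h: "h \<in> linear_maps R H A"
    and x: "x \<in> carrier H"
  shows "convolution A (convolution A f g) h x = convolution A f (convolution A g h) x"
proof -
  interpret A: assoc_algebra R A by fact
  note closed = linear_maps_closed[OF f] linear_maps_closed[OF g] linear_maps_closed[OF h]
  have "convolution A (convolution A f g) h x =
      sweedler R H A (\<lambda>s z. sweedler R H A (\<lambda>x y. (f x \<otimes>\<^bsub>A\<^esub> g y) \<otimes>\<^bsub>A\<^esub> h z) s) x"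
    unfolding convolution_def[of A "convolution A f g"]
  proof (rule sweedler_cong[OF A.module_axioms convolution_bilinear[OF A convolution_linear[OF A f g] h] _ x])
    fix s z assume sz: "s \<in> carrier H" "z \<in> carrier H"
    show "convolution A f g s \<otimes>\<^bsub>A\<^esub> h z = sweedler R H A (\<lambda>x y. (f x \<otimes>\<^bsub>A\<^esub> g y) \<otimes>\<^bsub>A\<^esub> h z) s"
      unfolding convolution_def
      by (rule linear_maps_sweedler[OF A.module_axioms A.module_axioms
            A.linear_maps_mult_left[OF linear_maps_id closed(3)[OF sz(2)]] convolution_bilinear[OF A f g] sz(1)])
  qed
  also have "\<dots> = sweedler R H A (\<lambda>x. sweedler R H A (\<lambda>y z. (f x \<otimes>\<^bsub>A\<^esub> g y) \<otimes>\<^bsub>A\<^esub> h z)) x"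
    by (rule sweedler_coassoc)
      (intro bilinear_mapsI A.linear_maps_mult_left A.linear_maps_mult_right closed A.A.m_closed
        f g h A.module_axioms x | assumption)+
  also have "\<dots> = convolution A f (convolution A g h) x"
    unfolding convolution_def[of A f]
  proof (rule sweedler_cong[OF A.module_axioms convolution_bilinear[OF A f convolution_linear[OF A g h]] _ x,
        symmetric])
    fix u s assume us: "u \<in> carrier H" "s \<in> carrier H"
    have "f u \<otimes>\<^bsub>A\<^esub> convolution A g h s = sweedler R H A (\<lambda>y z. f u \<otimes>\<^bsub>A\<^esub> (g y \<otimes>\<^bsub>A\<^esub> h z)) s"
      unfolding convolution_def
      by (rule linear_maps_sweedler[OF A.module_axioms A.module_axioms
            A.linear_maps_mult_right[OF closed(1)[OF us(1)] linear_maps_id] convolution_bilinear[OF A g h] us(2)])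
    also have "\<dots> = sweedler R H A (\<lambda>y z. (f u \<otimes>\<^bsub>A\<^esub> g y) \<otimes>\<^bsub>A\<^esub> h z) s"
      by (rule sweedler_cong[OF A.module_axioms bilinear_maps_compose[OF
              A.linear_maps_mult_right[OF closed(1)[OF us(1)] linear_maps_id] convolution_bilinear[OF A g h]] _ us(2)])
        (simp add: A.A.m_assoc closed us)
    finally show "f u \<otimes>\<^bsub>A\<^esub> convolution A g h s = \<dots>" .
  qed
  finally show ?thesis .
qed

text \<open>For \<open>a = \<one>\<close> this is the left unit law of convolution. The general constant is needed where a
  convolution equation is solved with a second argument held fixed.\<close>

lemma convolution_counit_left:
  assumes A: "assoc_algebra R A" and f: "f \<in> linear_maps R H A" and a: "a \<in> carrier A"
    and x: "x \<in> carrier H"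
  shows "convolution A (\<lambda>x. \<epsilon> x \<odot>\<^bsub>A\<^esub> a) f x = a \<otimes>\<^bsub>A\<^esub> f x"
proof -
  interpret A: assoc_algebra R A by fact
  have lin: "(\<lambda>x. \<epsilon> x \<odot>\<^bsub>A\<^esub> a) \<in> linear_maps R H A"
    by (intro linear_maps_scalar A.module_axioms counit_linear a)
  have "convolution A (\<lambda>x. \<epsilon> x \<odot>\<^bsub>A\<^esub> a) f x = sweedler R H A (\<lambda>y z. \<epsilon> y \<odot>\<^bsub>A\<^esub> (a \<otimes>\<^bsub>A\<^esub> f z)) x"
    unfolding convolution_def
    by (rule sweedler_cong[OF A.module_axioms convolution_bilinear[OF A lin f] _ x])
      (simp add: A.smult_mult_left linear_maps_closed[OF f] a)
  also have "\<dots> = a \<otimes>\<^bsub>A\<^esub> f x"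
    by (rule sweedler_counit_left[OF A.module_axioms A.linear_maps_mult_right[OF a f] x])
  finally show ?thesis .
qed

lemma convolution_unit_right:
  assumes A: "assoc_algebra R A" and f: "f \<in> linear_maps R H A" and x: "x \<in> carrier H"
  shows "convolution A f (\<lambda>x. \<epsilon> x \<odot>\<^bsub>A\<^esub> \<one>\<^bsub>A\<^esub>) x = f x"
proof -
  interpret A: assoc_algebra R A by fact
  have lin: "(\<lambda>x. \<epsilon> x \<odot>\<^bsub>A\<^esub> \<one>\<^bsub>A\<^esub>) \<in> linear_maps R H A"
    by (intro linear_maps_scalar A.module_axioms counit_linear A.A.one_closed)
  have "convolution A f (\<lambda>x. \<epsilon> x \<odot>\<^bsub>A\<^esub> \<one>\<^bsub>A\<^esub>) x = sweedler R H A (\<lambda>y z. \<epsilon> z \<odot>\<^bsub>A\<^esub> f y) x"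
    unfolding convolution_def
    by (rule sweedler_cong[OF A.module_axioms convolution_bilinear[OF A f lin] _ x])
      (simp add: A.smult_mult_right linear_maps_closed[OF f])
  also have "\<dots> = f x"
    by (rule sweedler_counit_right[OF A.module_axioms f x])
  finally show ?thesis .
qed

text \<open>An equation \<open>f g = q\<close> for convolution is solved by multiplying with an inverse \<open>h\<close> of \<open>g\<close> from
  the right.\<close>

lemma convolution_cancel_right:
  assumes A: "assoc_algebra R A"
    and f: "f \<in> linear_maps R H A" and g: "g \<in> linear_maps R H A" and h: "h \<in> linear_maps R H A"
    and fg: "\<And>x. x \<in> carrier H \<Longrightarrow> convolution A f g x = q x"
    and gh: "\<And>x. x \<in> carrier H \<Longrightarrow> convolution A g h x = \<epsilon> x \<odot>\<^bsub>A\<^esub> \<one>\<^bsub>A\<^esub>"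
    and x: "x \<in> carrier H"
  shows "f x = convolution A q h x"
proof -
  have "f x = convolution A f (\<lambda>x. \<epsilon> x \<odot>\<^bsub>A\<^esub> \<one>\<^bsub>A\<^esub>) x"
    by (rule convolution_unit_right[OF A f x, symmetric])
  also have "\<dots> = convolution A f (convolution A g h) x"
    by (rule convolution_cong[OF A f convolution_linear[OF A g h] refl gh x, symmetric])
  also have "\<dots> = convolution A (convolution A f g) h x"
    by (rule convolution_assoc[OF A f g h x, symmetric])
  also have "\<dots> = convolution A q h x"
    by (rule convolution_cong[OF A convolution_linear[OF A f g] h fg refl x])
  finally show ?thesis .
qed

lemma convolution_inverse_unique:
  assumes A: "assoc_algebra R A"
    and f: "f \<in> linear_maps R H A" and g: "g \<in> linear_maps R H A" and h: "h \<in> linear_maps R H A"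
    and fg: "\<And>x. x \<in> carrier H \<Longrightarrow> convolution A f g x = \<epsilon> x \<odot>\<^bsub>A\<^esub> \<one>\<^bsub>A\<^esub>"
    and gh: "\<And>x. x \<in> carrier H \<Longrightarrow> convolution A g h x = \<epsilon> x \<odot>\<^bsub>A\<^esub> \<one>\<^bsub>A\<^esub>"
    and x: "x \<in> carrier H"
  shows "f x = h x"
proof -
  interpret A: assoc_algebra R A by fact
  show ?thesis
    using convolution_cancel_right[OF A f g h fg gh x]
      convolution_counit_left[OF A h A.A.one_closed x] linear_maps_closed[OF h x]
    by simp
qed

section \<open>The antipode\<close>

lemma antipode_one: "S \<one>\<^bsub>H\<^esub> = \<one>\<^bsub>H\<^esub>"
proof -
  have "S \<one>\<^bsub>H\<^esub> \<otimes>\<^bsub>H\<^esub> \<one>\<^bsub>H\<^esub> = sweedler R H H (\<lambda>y z. S y \<otimes>\<^bsub>H\<^esub> z) \<one>\<^bsub>H\<^esub>"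
    by (rule sweedler_one[symmetric]) (intro multilinear | assumption)+
  then show ?thesis
    using sweedler_antipode_left[of "\<one>\<^bsub>H\<^esub>"] ring_hom_one[OF counit_ring_hom] by simp
qed

text \<open>Apply \<open>\<epsilon>\<close> to \<open>\<Sum> S x\<^sub>1 x\<^sub>2 = \<epsilon> x \<one>\<close>; the counit law turns the left hand side into \<open>\<epsilon> (S x)\<close>.\<close>

lemma counit_antipode:
  assumes x: "x \<in> carrier H"
  shows "\<epsilon> (S x) = \<epsilon> x"
proof -
  interpret G: module R "ground R" by (rule module_ground[OF R.cring_axioms])
  have b: "(\<lambda>y z. S y \<otimes>\<^bsub>H\<^esub> z) \<in> bilinear_maps R H H H" by (intro multilinear | assumption)+
  have "\<epsilon> (S x) = sweedler R H (ground R) (\<lambda>y z. \<epsilon> z \<odot>\<^bsub>ground R\<^esub> \<epsilon> (S y)) x"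
    by (rule sweedler_counit_right[OF G.module_axioms linear_maps_compose[OF counit_linear antipode_linear] x,
          symmetric])
  also have "\<dots> = sweedler R H (ground R) (\<lambda>y z. \<epsilon> (S y \<otimes>\<^bsub>H\<^esub> z)) x"
    by (rule sweedler_cong[OF G.module_axioms bilinear_maps_compose[OF counit_linear b] _ x, symmetric])
      (simp add: ring_hom_mult[OF counit_ring_hom] ground_def R.m_comm)
  also have "\<dots> = \<epsilon> (sweedler R H H (\<lambda>y z. S y \<otimes>\<^bsub>H\<^esub> z) x)"
    by (rule linear_maps_sweedler[OF module_axioms G.module_axioms counit_linear b x, symmetric])
  also have "\<dots> = \<epsilon> x"
    using x ring_hom_one[OF counit_ring_hom]
    by (simp add: sweedler_antipode_left linear_maps_smult[OF counit_linear] ground_def)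
  finally show ?thesis .
qed

text \<open>The antipode law at the product \<open>xy\<close> reads \<open>\<Sum> \<Sum> S (x\<^sub>1 y\<^sub>1) x\<^sub>2 y\<^sub>2 = \<epsilon> x \<epsilon> y \<one>\<close>. Instead of
  convolving on \<open>H \<otimes> H\<close>, the factors \<open>y\<^sub>2\<close> and \<open>x\<^sub>2\<close> are cancelled one at a time, each by a
  convolution in one variable: first \<open>\<Sum> S (x\<^sub>1 y) x\<^sub>2 = \<epsilon> x S y\<close>, for fixed \<open>x\<close>, and from this
  \<open>S (xy) = S y S x\<close>, for fixed \<open>y\<close>.\<close>

lemma antipode_mult:
  assumes x: "x \<in> carrier H" and y: "y \<in> carrier H"
  shows "S (x \<otimes>\<^bsub>H\<^esub> y) = S y \<otimes>\<^bsub>H\<^esub> S x"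
proof -
  define G where "G x y = sweedler R H H (\<lambda>a b. S (a \<otimes>\<^bsub>H\<^esub> y) \<otimes>\<^bsub>H\<^esub> b) x" for x y
  have G_lin: "G x \<in> linear_maps R H H" if "x \<in> carrier H" for x
    unfolding G_def using that by (intro multilinear | assumption)+
  note A = assoc_algebra_axioms
  have id_S: "convolution H (\<lambda>x. x) S z = \<epsilon> z \<odot>\<^bsub>H\<^esub> \<one>\<^bsub>H\<^esub>" if "z \<in> carrier H" for z
    unfolding convolution_def using that by (rule sweedler_antipode_right)
  have G: "G x y = \<epsilon> x \<odot>\<^bsub>H\<^esub> S y" if x: "x \<in> carrier H" and y: "y \<in> carrier H" for x y
  proof -
    \<comment> \<open>As a function of \<open>y\<close>, the convolution of \<open>G x\<close> with the identity is the left hand side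
      of the antipode law at \<open>xy\<close>.\<close>
    have conv: "convolution H (G x) (\<lambda>y. y) y = \<epsilon> y \<odot>\<^bsub>H\<^esub> (\<epsilon> x \<odot>\<^bsub>H\<^esub> \<one>\<^bsub>H\<^esub>)" if y: "y \<in> carrier H" for y
    proof -
      have "convolution H (G x) (\<lambda>y. y) y =
          sweedler R H H (\<lambda>c d. sweedler R H H (\<lambda>a b. S (a \<otimes>\<^bsub>H\<^esub> c) \<otimes>\<^bsub>H\<^esub> (b \<otimes>\<^bsub>H\<^esub> d)) x) y"
        unfolding convolution_def
      proof (rule sweedler_cong[OF module_axioms convolution_bilinear[OF A G_lin[OF x] linear_maps_id] _ y])
        fix c d assume cd: "c \<in> carrier H" "d \<in> carrier H"
        have b: "(\<lambda>a b. S (a \<otimes>\<^bsub>H\<^esub> c) \<otimes>\<^bsub>H\<^esub> b) \<in> bilinear_maps R H H H"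
          using cd by (intro multilinear | assumption)+
        note d = linear_maps_mult_left[OF linear_maps_id cd(2)]
        have "G x c \<otimes>\<^bsub>H\<^esub> d = sweedler R H H (\<lambda>a b. S (a \<otimes>\<^bsub>H\<^esub> c) \<otimes>\<^bsub>H\<^esub> b \<otimes>\<^bsub>H\<^esub> d) x"
          unfolding G_def by (rule linear_maps_sweedler[OF module_axioms module_axioms d b x])
        also have "\<dots> = sweedler R H H (\<lambda>a b. S (a \<otimes>\<^bsub>H\<^esub> c) \<otimes>\<^bsub>H\<^esub> (b \<otimes>\<^bsub>H\<^esub> d)) x"
          by (rule sweedler_cong[OF module_axioms bilinear_maps_compose[OF d b] _ x])
            (simp add: H.m_assoc cd)
        finally show "G x c \<otimes>\<^bsub>H\<^esub> d = \<dots>" .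
      qed
      also have "\<dots> = sweedler R H H
          (\<lambda>a b. sweedler R H H (\<lambda>c d. S (a \<otimes>\<^bsub>H\<^esub> c) \<otimes>\<^bsub>H\<^esub> (b \<otimes>\<^bsub>H\<^esub> d)) y) x"
        by (rule sweedler_swap) (intro multilinear x y | assumption)+
      also have "\<dots> = sweedler R H H (\<lambda>u v. S u \<otimes>\<^bsub>H\<^esub> v) (x \<otimes>\<^bsub>H\<^esub> y)"
        by (rule sweedler_mult[symmetric]) (intro multilinear x y | assumption)+
      also have "\<dots> = \<epsilon> y \<odot>\<^bsub>H\<^esub> (\<epsilon> x \<odot>\<^bsub>H\<^esub> \<one>\<^bsub>H\<^esub>)"
        using x y by (simp add: sweedler_antipode_left ring_hom_mult[OF counit_ring_hom]
            smult_assoc1[symmetric] R.m_comm)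
      finally show ?thesis .
    qed
    have "G x y = convolution H (\<lambda>y. \<epsilon> y \<odot>\<^bsub>H\<^esub> (\<epsilon> x \<odot>\<^bsub>H\<^esub> \<one>\<^bsub>H\<^esub>)) S y"
      by (rule convolution_cancel_right[OF A G_lin[OF x] linear_maps_id antipode_linear conv id_S y])
    then show ?thesis
      using x y by (simp add: convolution_counit_left[OF A antipode_linear] smult_mult_left)
  qed
  have "S (x \<otimes>\<^bsub>H\<^esub> y) = convolution H (\<lambda>x. \<epsilon> x \<odot>\<^bsub>H\<^esub> S y) S x"
  proof (rule convolution_cancel_right[OF A _ linear_maps_id antipode_linear _ id_S x])
    show "(\<lambda>x. S (x \<otimes>\<^bsub>H\<^esub> y)) \<in> linear_maps R H H"
      using y by (intro multilinear | assumption)+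
    show "convolution H (\<lambda>x. S (x \<otimes>\<^bsub>H\<^esub> y)) (\<lambda>x. x) z = \<epsilon> z \<odot>\<^bsub>H\<^esub> S y" if "z \<in> carrier H" for z
      using G[OF that y] by (simp add: convolution_def G_def)
  qed
  then show ?thesis
    using x y by (simp add: convolution_counit_left[OF A antipode_linear])
qed

text \<open>Both sides are inverse to \<open>\<Delta>\<close> for the convolution of maps from \<open>H\<close> to \<open>H \<otimes> H\<close>. For the left hand
  side this holds because \<open>\<Delta>\<close> is a map of algebras. For the right hand side the product is
  \<open>\<Sum> x\<^sub>1 S x\<^sub>4 \<otimes> x\<^sub>2 S x\<^sub>3\<close>, which collapses from the inside: first \<open>x\<^sub>2 S x\<^sub>3\<close>, then \<open>x\<^sub>1 S x\<^sub>4\<close>.\<close>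

lemma comult_antipode:
  assumes x: "x \<in> carrier H"
  shows "\<Delta> (S x) = sweedler R H (tensor_space R H H) (\<lambda>y z. pure_tensor R H H (S z) (S y)) x"
proof -
  let ?HH = "tensor_space R H H"
  let ?A = "tensor_algebra R H H"
  let ?t = "pure_tensor R H H"
  let ?S = "sweedler R H ?HH (\<lambda>y z. ?t (S z) (S y))"
  note A = HH.assoc_algebra_tensor_algebra
  interpret A: assoc_algebra R ?A by (rule A)
  note lin = linear_maps_tensor_algebra
  have b: "(\<lambda>y z. ?t (S z) (S y)) \<in> bilinear_maps R H H ?HH"
    by (intro multilinear | assumption)+
  have S_lin: "?S \<in> linear_maps R H ?A"
    unfolding lin by (intro multilinear sweedler_linear[OF _ _ linear_maps_id] | assumption)+
  have \<Delta>_lin: "\<Delta> \<in> linear_maps R H ?A"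
    unfolding lin by (rule comult_linear)
  have \<Delta>S_lin: "(\<lambda>x. \<Delta> (S x)) \<in> linear_maps R H ?A"
    by (rule linear_maps_compose[OF \<Delta>_lin antipode_linear])
  show ?thesis
  proof (rule convolution_inverse_unique[OF A \<Delta>S_lin \<Delta>_lin S_lin _ _ x])
    fix x assume x: "x \<in> carrier H"
    have c: "(\<lambda>y z. S y \<otimes>\<^bsub>H\<^esub> z) \<in> bilinear_maps R H H H" by (intro multilinear | assumption)+
    have "convolution ?A (\<lambda>x. \<Delta> (S x)) \<Delta> x = sweedler R H ?A (\<lambda>y z. \<Delta> (S y \<otimes>\<^bsub>H\<^esub> z)) x"
      unfolding convolution_def
      by (rule sweedler_cong[OF A.module_axioms bilinear_maps_compose[OF \<Delta>_lin c] _ x, symmetric])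
        (simp add: ring_hom_mult[OF comult_ring_hom])
    also have "\<dots> = \<Delta> (sweedler R H H (\<lambda>y z. S y \<otimes>\<^bsub>H\<^esub> z) x)"
      by (rule linear_maps_sweedler[OF module_axioms A.module_axioms \<Delta>_lin c x, symmetric])
    also have "\<dots> = \<epsilon> x \<odot>\<^bsub>?A\<^esub> \<one>\<^bsub>?A\<^esub>"
      using x ring_hom_one[OF comult_ring_hom]
      by (simp add: sweedler_antipode_left linear_maps_smult[OF comult_linear])
    finally show "convolution ?A (\<lambda>x. \<Delta> (S x)) \<Delta> x = \<dots>" .
  next
    fix x assume x: "x \<in> carrier H"
    have "convolution ?A \<Delta> ?S x = sweedler R H ?HH (\<lambda>u w. sweedler R H ?HH (\<lambda>a b.
        sweedler R H ?HH (\<lambda>c d. ?t (a \<otimes>\<^bsub>H\<^esub> S d) (b \<otimes>\<^bsub>H\<^esub> S c)) w) u) x"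
      unfolding convolution_def sweedler_tensor_algebra
    proof (rule sweedler_cong[OF HH.module_T _ _ x])
      show "(\<lambda>y z. \<Delta> y \<otimes>\<^bsub>?A\<^esub> ?S z) \<in> bilinear_maps R H H ?HH"
        using convolution_bilinear[OF A \<Delta>_lin S_lin] by (simp add: bilinear_maps_tensor_algebra)
      fix u w assume uw: "u \<in> carrier H" "w \<in> carrier H"
      have Sw: "?S w \<in> carrier ?HH" using linear_maps_closed[OF S_lin uw(2)] by simp
      have "\<Delta> u \<otimes>\<^bsub>?A\<^esub> ?S w = sweedler R H ?HH (\<lambda>a b.
          tensor_lift R ?HH (\<lambda>c d. ?t (a \<otimes>\<^bsub>H\<^esub> c) (b \<otimes>\<^bsub>H\<^esub> d)) (?S w)) u"
        by (simp add: HH.tensor_mult_def sweedler_def)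
      also have "\<dots> = sweedler R H ?HH (\<lambda>a b.
          sweedler R H ?HH (\<lambda>c d. ?t (a \<otimes>\<^bsub>H\<^esub> S d) (b \<otimes>\<^bsub>H\<^esub> S c)) w) u"
      proof (rule sweedler_cong[OF HH.module_T HH.tensor_mult_outer[OF Sw] _ uw(1)])
        fix a a' assume a: "a \<in> carrier H" "a' \<in> carrier H"
        note i = HH.tensor_mult_inner[OF a]
        note j = HH.tensor_lift_linear[OF HH.module_T i]
        have "tensor_lift R ?HH (\<lambda>c d. ?t (a \<otimes>\<^bsub>H\<^esub> c) (a' \<otimes>\<^bsub>H\<^esub> d)) (?S w) =
          sweedler R H ?HH (\<lambda>y z. tensor_lift R ?HH (\<lambda>c d. ?t (a \<otimes>\<^bsub>H\<^esub> c) (a' \<otimes>\<^bsub>H\<^esub> d)) (?t (S z) (S y))) w"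
          by (rule linear_maps_sweedler[OF HH.module_T HH.module_T j b uw(2)])
        also have "\<dots> = sweedler R H ?HH (\<lambda>c d. ?t (a \<otimes>\<^bsub>H\<^esub> S d) (a' \<otimes>\<^bsub>H\<^esub> S c)) w"
          by (rule sweedler_cong[OF HH.module_T bilinear_maps_compose[OF j b] _ uw(2)])
            (simp add: HH.tensor_lift_pure[OF HH.module_T i])
        finally show "tensor_lift R ?HH (\<lambda>c d. ?t (a \<otimes>\<^bsub>H\<^esub> c) (a' \<otimes>\<^bsub>H\<^esub> d)) (?S w) = \<dots>" .
      qed
      finally show "\<Delta> u \<otimes>\<^bsub>?A\<^esub> ?S w = \<dots>" .
    qed
    \<comment> \<open>So far \<open>x\<close> is split in the middle, into \<open>x\<^sub>1, x\<^sub>2\<close> and \<open>x\<^sub>3, x\<^sub>4\<close>. Coassociativity, here and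
      again inside, regroups it as \<open>x\<^sub>1\<close>, then the pair \<open>x\<^sub>2, x\<^sub>3\<close>, then \<open>x\<^sub>4\<close>.\<close>
    also have "\<dots> = sweedler R H ?HH (\<lambda>a. sweedler R H ?HH (\<lambda>b w.
        sweedler R H ?HH (\<lambda>c d. ?t (a \<otimes>\<^bsub>H\<^esub> S d) (b \<otimes>\<^bsub>H\<^esub> S c)) w)) x"
      by (rule sweedler_coassoc) (intro multilinear x | assumption)+
    also have "\<dots> = sweedler R H ?HH (\<lambda>a v. ?t (a \<otimes>\<^bsub>H\<^esub> S v) \<one>\<^bsub>H\<^esub>) x"
    proof (rule sweedler_cong[OF HH.module_T _ _ x])
      show "(\<lambda>a. sweedler R H ?HH (\<lambda>b w. sweedler R H ?HH
          (\<lambda>c d. ?t (a \<otimes>\<^bsub>H\<^esub> S d) (b \<otimes>\<^bsub>H\<^esub> S c)) w)) \<in> bilinear_maps R H H ?HH"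
        by (intro multilinear sweedler_linear[OF _ _ linear_maps_id] | assumption)+
      fix a v assume av: "a \<in> carrier H" "v \<in> carrier H"
      have "sweedler R H ?HH (\<lambda>b w. sweedler R H ?HH (\<lambda>c d. ?t (a \<otimes>\<^bsub>H\<^esub> S d) (b \<otimes>\<^bsub>H\<^esub> S c)) w) v =
          sweedler R H ?HH (\<lambda>p d. sweedler R H ?HH (\<lambda>b c. ?t (a \<otimes>\<^bsub>H\<^esub> S d) (b \<otimes>\<^bsub>H\<^esub> S c)) p) v"
        using av by (intro sweedler_coassoc[symmetric]) (intro multilinear | assumption)+
      also have "\<dots> = sweedler R H ?HH (\<lambda>p d. \<epsilon> p \<odot>\<^bsub>?HH\<^esub> ?t (a \<otimes>\<^bsub>H\<^esub> S d) \<one>\<^bsub>H\<^esub>) v"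
      proof (rule sweedler_cong[OF HH.module_T _ _ av(2)])
        show "(\<lambda>p d. sweedler R H ?HH (\<lambda>b c. ?t (a \<otimes>\<^bsub>H\<^esub> S d) (b \<otimes>\<^bsub>H\<^esub> S c)) p)
            \<in> bilinear_maps R H H ?HH"
          using av by (intro multilinear sweedler_linear[OF _ _ linear_maps_id] | assumption)+
        fix p d assume pd: "p \<in> carrier H" "d \<in> carrier H"
        have l: "?t (a \<otimes>\<^bsub>H\<^esub> S d) \<in> linear_maps R H ?HH"
          using av pd by (intro bilinear_maps_right[OF HH.pure_tensor_bilinear]) simp
        have "sweedler R H ?HH (\<lambda>b c. ?t (a \<otimes>\<^bsub>H\<^esub> S d) (b \<otimes>\<^bsub>H\<^esub> S c)) p =
            ?t (a \<otimes>\<^bsub>H\<^esub> S d) (sweedler R H H (\<lambda>b c. b \<otimes>\<^bsub>H\<^esub> S c) p)"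
          by (rule linear_maps_sweedler[OF module_axioms HH.module_T l _ pd(1), symmetric])
            (intro multilinear | assumption)+
        then show "sweedler R H ?HH (\<lambda>b c. ?t (a \<otimes>\<^bsub>H\<^esub> S d) (b \<otimes>\<^bsub>H\<^esub> S c)) p =
            \<epsilon> p \<odot>\<^bsub>?HH\<^esub> ?t (a \<otimes>\<^bsub>H\<^esub> S d) \<one>\<^bsub>H\<^esub>"
          using pd by (simp add: sweedler_antipode_right linear_maps_smult[OF l])
      qed
      also have "\<dots> = ?t (a \<otimes>\<^bsub>H\<^esub> S v) \<one>\<^bsub>H\<^esub>"
        using av by (intro sweedler_counit_left HH.module_T) (intro multilinear H.one_closed | assumption)+
      finally show "sweedler R H ?HH (\<lambda>b w. sweedler R H ?HH
          (\<lambda>c d. ?t (a \<otimes>\<^bsub>H\<^esub> S d) (b \<otimes>\<^bsub>H\<^esub> S c)) w) v = \<dots>" .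
    qed
    also have "\<dots> = ?t (sweedler R H H (\<lambda>a v. a \<otimes>\<^bsub>H\<^esub> S v) x) \<one>\<^bsub>H\<^esub>"
      by (rule linear_maps_sweedler[OF module_axioms HH.module_T
            bilinear_maps_left[OF HH.pure_tensor_bilinear H.one_closed] _ x, symmetric])
        (intro multilinear | assumption)+
    also have "\<dots> = \<epsilon> x \<odot>\<^bsub>?A\<^esub> \<one>\<^bsub>?A\<^esub>"
      using x by (simp add: sweedler_antipode_right
          linear_maps_smult[OF bilinear_maps_left[OF HH.pure_tensor_bilinear H.one_closed]])
    finally show "convolution ?A \<Delta> ?S x = \<dots>" .
  qed
qed

end

section \<open>The opposite co-opposite Hopf algebra\<close>

lemma op_cop_simps [simp]:
  "carrier (op_cop R H) = carrier H"
  "add (op_cop R H) = add H"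
  "zero (op_cop R H) = zero H"
  "one (op_cop R H) = one H"
  "smult (op_cop R H) = smult H"
  "counit (op_cop R H) = counit H"
  "antipode (op_cop R H) = antipode H"
  "x \<otimes>\<^bsub>op_cop R H\<^esub> y = y \<otimes>\<^bsub>H\<^esub> x"
  "comult (op_cop R H) = (\<lambda>x. tensor_flip R H H (comult H x))"
  by (simp_all add: op_cop_def)

lemma linear_maps_op_cop [simp]:
  "linear_maps R (op_cop R H) = linear_maps R H"
  "linear_maps R M (op_cop R H) = linear_maps R M H"
  by (simp_all add: linear_maps_def fun_eq_iff)

text \<open>Tensor products and lifts depend on the underlying modules only, and these are not changed by
  passing to \<open>H\<^sup>o\<^sup>p\<^sup>,\<^sup>c\<^sup>o\<^sup>p\<close>.\<close>

lemma tensor_op_cop [simp]: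
  "tensor_space R (op_cop R H) = tensor_space R H"
  "tensor_space R M (op_cop R H) = tensor_space R M H"
  "pure_tensor R (op_cop R H) = pure_tensor R H"
  "pure_tensor R M (op_cop R H) = pure_tensor R M H"
  "tensor_lift R (op_cop R H) = tensor_lift R H"
  by (simp_all add: tensor_space_def pure_tensor_def bilinear_submodule_def bilinear_relations_def
      tensor_lift_def finsum_def fun_eq_iff)

lemma tensor_map_op_cop [simp]:
  "tensor_map R (op_cop R H) = tensor_map R H"
  "tensor_map R M (op_cop R H) = tensor_map R M H"
  by (simp_all add: tensor_map_def fun_eq_iff)

lemma tensor_assoc_op_cop [simp]:
  "tensor_assoc R (op_cop R H) (op_cop R H) (op_cop R H) = tensor_assoc R H H H"
  by (simp add: tensor_assoc_def fun_eq_iff)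

context hopf_algebra
begin

abbreviation "Hoc \<equiv> op_cop R H"

lemma tensor_lift_flip_comult:
  assumes "module R P" "b \<in> bilinear_maps R H H P" "x \<in> carrier H"
  shows "tensor_lift R P b (tensor_flip R H H (\<Delta> x)) = sweedler R H P (\<lambda>y z. b z y) x"
  unfolding sweedler_def
  by (rule tensor_lift_flip[OF HH.tensor_product_axioms assms(1,2) comult_closed[OF assms(3)]])

lemma tensor_flip_comult:
  "x \<in> carrier H \<Longrightarrow>
    tensor_flip R H H (\<Delta> x) = sweedler R H (tensor_space R H H) (\<lambda>y z. pure_tensor R H H z y) x"
  by (simp add: sweedler_def tensor_flip_def)

lemma coopposite_linear:
  "(\<lambda>x. tensor_flip R H H (\<Delta> x)) \<in> linear_maps R H (tensor_space R H H)"
  by (rule linear_maps_compose[OF tensor_flip_linear[OF HH.tensor_product_axioms] comult_linear])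

text \<open>Evaluated on a trilinear map, the two iterated comultiplications give \<open>\<phi> x\<^sub>3 x\<^sub>2 x\<^sub>1\<close> with the
  two possible splittings, so coassociativity of \<open>\<Delta>\<close>, read from right to left, identifies them. The
  universal trilinear map \<open>\<phi> x y z = x \<otimes> (y \<otimes> z)\<close> yields the law itself.\<close>

lemma coopposite_coassoc:
  assumes x: "x \<in> carrier H"
  defines "D \<equiv> \<lambda>x. tensor_flip R H H (\<Delta> x)"
  shows "tensor_assoc R H H H (tensor_map R (tensor_space R H H) H D (\<lambda>y. y) (D x)) =
    tensor_map R H (tensor_space R H H) (\<lambda>y. y) D (D x)"
proof -
  let ?HH = "tensor_space R H H"
  have L: "tensor_product R ?HH H"
    by (intro tensor_product.intro HH.module_T module_axioms)
  have R: "tensor_product R H ?HH"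
    by (intro tensor_product.intro HH.module_T module_axioms)
  interpret L: tensor_product R ?HH H by (rule L)
  interpret R: tensor_product R H ?HH by (rule R)
  note HHt = HH.tensor_product_axioms
  define \<phi> where "\<phi> x y z = pure_tensor R H ?HH x (pure_tensor R H H y z)" for x y z
  have D: "D \<in> linear_maps R H ?HH" unfolding D_def by (rule coopposite_linear)
  note Dc = linear_maps_closed[OF D]
  note intr = multilinear R.linear_maps_pure_left R.linear_maps_pure_right R.module_T
    HH.tensor_lift_linear_param HH.tensor_lift_linear linear_maps_compose[OF D]
    HH.linear_maps_tensor_lift_arg
    R.pure_tensor_closed
  have b1: "(\<lambda>s z. tensor_lift R R.T (\<lambda>x y. \<phi> x y z) s) \<in> bilinear_maps R ?HH H R.T"
    unfolding \<phi>_def by (intro intr | assumption)+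
  have b2: "(\<lambda>s z. tensor_lift R R.T (\<lambda>x y. \<phi> x y z) (D s)) \<in> bilinear_maps R H H R.T"
    unfolding \<phi>_def by (intro intr Dc | assumption)+
  have b3: "(\<lambda>x y. pure_tensor R H ?HH x (D y)) \<in> bilinear_maps R H H R.T"
    by (intro intr Dc | assumption)+
  have "tensor_assoc R H H H (tensor_map R ?HH H D (\<lambda>y. y) (D x)) =
      tensor_lift R R.T (\<lambda>s z. tensor_lift R R.T (\<lambda>x y. \<phi> x y z) s)
        (tensor_map R ?HH H D (\<lambda>y. y) (D x))"
    by (simp add: tensor_assoc_def Let_def \<phi>_def)
  also have "\<dots> = tensor_lift R R.T (\<lambda>s z. tensor_lift R R.T (\<lambda>x y. \<phi> x y z) (D s)) (D x)"
    by (rule tensor_lift_map[OF HHt L R.module_T D linear_maps_id b1 Dc[OF x]])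
  also have "\<dots> = sweedler R H R.T (\<lambda>z s. tensor_lift R R.T (\<lambda>x y. \<phi> x y z) (D s)) x"
    unfolding D_def
    by (rule tensor_lift_flip_comult[OF R.module_T b2[unfolded D_def] x])
  also have "\<dots> = sweedler R H R.T (\<lambda>z. sweedler R H R.T (\<lambda>y x. \<phi> x y z)) x"
  proof (rule sweedler_cong[OF R.module_T bilinear_maps_swap[OF b2] _ x])
    fix z s assume zs: "z \<in> carrier H" "s \<in> carrier H"
    show "tensor_lift R R.T (\<lambda>x y. \<phi> x y z) (D s) = sweedler R H R.T (\<lambda>y x. \<phi> x y z) s"
      unfolding D_def \<phi>_def using zs
      by (intro tensor_lift_flip_comult) (intro intr | assumption)+
  qed
  also have "\<dots> = sweedler R H R.T (\<lambda>s x. sweedler R H R.T (\<lambda>z y. \<phi> x y z) s) x"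
    unfolding \<phi>_def
    by (rule sweedler_coassoc[symmetric]) (intro intr x | assumption)+
  also have "\<dots> = sweedler R H R.T (\<lambda>s x. pure_tensor R H ?HH x (D s)) x"
  proof (rule sweedler_cong[OF R.module_T bilinear_maps_swap[OF b3] _ x, symmetric])
    fix s x assume sx: "s \<in> carrier H" "x \<in> carrier H"
    have "pure_tensor R H ?HH x (D s) = pure_tensor R H ?HH x
        (sweedler R H ?HH (\<lambda>z y. pure_tensor R H H y z) s)"
      unfolding D_def tensor_flip_comult[OF sx(1)] ..
    also have "\<dots> = sweedler R H R.T (\<lambda>z y. \<phi> x y z) s"
      unfolding \<phi>_def
      by (rule linear_maps_sweedler[OF HH.module_T R.module_T
            bilinear_maps_right[OF R.pure_tensor_bilinear sx(2)] _ sx(1)]) (intro intr | assumption)+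
    finally show "pure_tensor R H ?HH x (D s) = \<dots>" .
  qed
  also have "\<dots> = tensor_lift R R.T (\<lambda>x s. pure_tensor R H ?HH x (D s)) (D x)"
    unfolding D_def
    by (rule tensor_lift_flip_comult[OF R.module_T b3[unfolded D_def] x, symmetric])
  also have "\<dots> = tensor_map R H ?HH (\<lambda>y. y) D (D x)"
    by (simp add: tensor_map_def)
  finally show ?thesis .
qed

text \<open>Both sides are the double sum of \<open>y\<^sub>2 x\<^sub>2 \<otimes> y\<^sub>1 x\<^sub>1\<close>, once summed over \<open>x\<close> first and once over \<open>y\<close>
  first.\<close>

lemma coopposite_mult:
  assumes x: "x \<in> carrier H" and y: "y \<in> carrier H"
  shows "tensor_flip R H H (\<Delta> (y \<otimes>\<^bsub>H\<^esub> x)) =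
    tensor_flip R H H (\<Delta> x) \<otimes>\<^bsub>tensor_algebra R Hoc Hoc\<^esub> tensor_flip R H H (\<Delta> y)"
proof -
  let ?HH = "tensor_space R H H"
  let ?t = "pure_tensor R H H"
  have 0: "(\<lambda>a b. ?t b a) \<in> bilinear_maps R H H ?HH"
    by (intro multilinear | assumption)+
  note fl = linear_maps_closed[OF coopposite_linear]
  have 1: "(\<lambda>c d. ?t (c \<otimes>\<^bsub>H\<^esub> a) (d \<otimes>\<^bsub>H\<^esub> b)) \<in> bilinear_maps R H H ?HH"
    if "a \<in> carrier H" "b \<in> carrier H" for a b
    using that by (intro multilinear | assumption)+
  have 2: "(\<lambda>a b. tensor_lift R ?HH (\<lambda>c d. ?t (c \<otimes>\<^bsub>H\<^esub> a) (d \<otimes>\<^bsub>H\<^esub> b)) (tensor_flip R H H (\<Delta> y)))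
      \<in> bilinear_maps R H H ?HH"
    by (intro multilinear HH.tensor_lift_linear_param fl y | assumption)+
  have "tensor_flip R H H (\<Delta> x) \<otimes>\<^bsub>tensor_algebra R Hoc Hoc\<^esub> tensor_flip R H H (\<Delta> y) =
      tensor_lift R ?HH (\<lambda>a b. tensor_lift R ?HH (\<lambda>c d. ?t (c \<otimes>\<^bsub>H\<^esub> a) (d \<otimes>\<^bsub>H\<^esub> b))
        (tensor_flip R H H (\<Delta> y))) (tensor_flip R H H (\<Delta> x))"
    by (simp add: tensor_algebra_def Let_def)
  also have "\<dots> = sweedler R H ?HH (\<lambda>b a. tensor_lift R ?HH (\<lambda>c d. ?t (c \<otimes>\<^bsub>H\<^esub> a) (d \<otimes>\<^bsub>H\<^esub> b))
        (tensor_flip R H H (\<Delta> y))) x"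
    by (rule tensor_lift_flip_comult[OF HH.module_T 2 x])
  also have "\<dots> = sweedler R H ?HH (\<lambda>b a. sweedler R H ?HH (\<lambda>d c. ?t (c \<otimes>\<^bsub>H\<^esub> a) (d \<otimes>\<^bsub>H\<^esub> b)) y) x"
    by (rule sweedler_cong[OF HH.module_T bilinear_maps_swap[OF 2] _ x])
      (rule tensor_lift_flip_comult[OF HH.module_T 1 y])
  also have "\<dots> = sweedler R H ?HH (\<lambda>d c. sweedler R H ?HH (\<lambda>b a. ?t (c \<otimes>\<^bsub>H\<^esub> a) (d \<otimes>\<^bsub>H\<^esub> b)) x) y"
    by (rule sweedler_swap) (intro multilinear x y | assumption)+
  also have "\<dots> = sweedler R H ?HH (\<lambda>a b. ?t b a) (y \<otimes>\<^bsub>H\<^esub> x)"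
    by (rule sweedler_mult[OF HH.module_T 0 y x, symmetric])
  also have "\<dots> = tensor_flip R H H (\<Delta> (y \<otimes>\<^bsub>H\<^esub> x))"
    by (rule tensor_flip_comult[symmetric]) (simp add: x y)
  finally show ?thesis ..
qed

lemma hopf_algebra_op_cop: "hopf_algebra R Hoc"
proof -
  have group: "abelian_group Hoc"
  proof (rule abelian_groupI)
    fix x assume "x \<in> carrier Hoc"
    then show "\<exists>y\<in>carrier Hoc. y \<oplus>\<^bsub>Hoc\<^esub> x = \<zero>\<^bsub>Hoc\<^esub>"
      by (intro bexI[of _ "\<ominus>\<^bsub>H\<^esub> x"]) (simp_all add: M.l_neg)
  qed (simp_all add: M.a_ac)
  have mod: "module R Hoc"
    by (rule moduleI[OF R.cring_axioms group])
      (simp_all add: smult_l_distr smult_r_distr smult_assoc1)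
  have ring: "ring Hoc"
    by (intro ringI group monoidI) (simp_all add: H.m_assoc H.l_distr H.r_distr)
  show ?thesis
  proof (intro hopf_algebra.intro hopf_algebra_axioms.intro mod ring)
    show "comult Hoc \<in> linear_maps R Hoc (tensor_space R Hoc Hoc)"
      using coopposite_linear by simp
    show "counit Hoc \<in> linear_maps R Hoc (ground R)" "antipode Hoc \<in> linear_maps R Hoc Hoc"
      using counit_linear antipode_linear by simp_all
    show "counit Hoc \<in> ring_hom Hoc R"
      by (rule ring_hom_memI)
        (simp_all add: ring_hom_mult[OF counit_ring_hom] ring_hom_add[OF counit_ring_hom]
          ring_hom_one[OF counit_ring_hom] R.m_comm)
    show "comult Hoc \<in> ring_hom Hoc (tensor_algebra R Hoc Hoc)"
    proof (rule ring_hom_memI)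
      show "comult Hoc \<one>\<^bsub>Hoc\<^esub> = \<one>\<^bsub>tensor_algebra R Hoc Hoc\<^esub>"
        using sweedler_one[OF HH.module_T tensor_flip_bilinear[OF HH.tensor_product_axioms]]
        by (simp add: tensor_flip_comult)
    qed (simp_all add: coopposite_mult linear_maps_add[OF coopposite_linear]
        linear_maps_closed[OF coopposite_linear])
  next
    fix x assume "x \<in> carrier Hoc"
    then have x: "x \<in> carrier H" by simp
    show "tensor_assoc R Hoc Hoc Hoc (tensor_map R (tensor_space R Hoc Hoc) Hoc (comult Hoc) (\<lambda>y. y) (comult Hoc x)) =
        tensor_map R Hoc (tensor_space R Hoc Hoc) (\<lambda>y. y) (comult Hoc) (comult Hoc x)"
      using coopposite_coassoc[OF x] by simp
    have "tensor_lift R H (\<lambda>y z. \<epsilon> y \<odot>\<^bsub>H\<^esub> z) (tensor_flip R H H (\<Delta> x)) =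
        sweedler R H H (\<lambda>z y. \<epsilon> y \<odot>\<^bsub>H\<^esub> z) x"
      by (intro tensor_lift_flip_comult module_axioms bilinear_mapsI linear_maps_smult_const
          linear_maps_scalar counit_linear linear_maps_id counit_closed x)
    then show "tensor_lift R Hoc (\<lambda>y z. counit Hoc y \<odot>\<^bsub>Hoc\<^esub> z) (comult Hoc x) = x"
      using sweedler_counit_right[OF module_axioms linear_maps_id x] by simp
    have "tensor_lift R H (\<lambda>y z. \<epsilon> z \<odot>\<^bsub>H\<^esub> y) (tensor_flip R H H (\<Delta> x)) =
        sweedler R H H (\<lambda>z y. \<epsilon> z \<odot>\<^bsub>H\<^esub> y) x"
      by (intro tensor_lift_flip_comult module_axioms bilinear_mapsI linear_maps_smult_const
          linear_maps_scalar counit_linear linear_maps_id counit_closed x)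
    then show "tensor_lift R Hoc (\<lambda>y z. counit Hoc z \<odot>\<^bsub>Hoc\<^esub> y) (comult Hoc x) = x"
      using sweedler_counit_left[OF module_axioms linear_maps_id x] by simp
    have "tensor_lift R H (\<lambda>y z. z \<otimes>\<^bsub>H\<^esub> S y) (tensor_flip R H H (\<Delta> x)) =
        sweedler R H H (\<lambda>z y. z \<otimes>\<^bsub>H\<^esub> S y) x"
      by (rule tensor_lift_flip_comult) (intro multilinear x | assumption)+
    then show "tensor_lift R Hoc (\<lambda>y z. antipode Hoc y \<otimes>\<^bsub>Hoc\<^esub> z) (comult Hoc x) = counit Hoc x \<odot>\<^bsub>Hoc\<^esub> \<one>\<^bsub>Hoc\<^esub>"
      using sweedler_antipode_right[OF x] by simp
    have "tensor_lift R H (\<lambda>y z. S z \<otimes>\<^bsub>H\<^esub> y) (tensor_flip R H H (\<Delta> x)) =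
        sweedler R H H (\<lambda>z y. S z \<otimes>\<^bsub>H\<^esub> y) x"
      by (rule tensor_lift_flip_comult) (intro multilinear x | assumption)+
    then show "tensor_lift R Hoc (\<lambda>y z. y \<otimes>\<^bsub>Hoc\<^esub> antipode Hoc z) (comult Hoc x) = counit Hoc x \<odot>\<^bsub>Hoc\<^esub> \<one>\<^bsub>Hoc\<^esub>"
      using sweedler_antipode_left[OF x] by simp
  qed (simp_all add: smult_mult_left smult_mult_right)
qed

lemma antipode_hopf_hom: "hopf_hom R H Hoc S"
proof (intro hopf_hom.intro hopf_hom_axioms.intro hopf_algebra_axioms hopf_algebra_op_cop)
  show "S \<in> linear_maps R H Hoc" using antipode_linear by simp
  show "S \<in> ring_hom H Hoc"
    by (rule ring_hom_memI)
      (simp_all add: antipode_mult antipode_one linear_maps_add[OF antipode_linear])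
next
  fix x assume x: "x \<in> carrier H"
  let ?HH = "tensor_space R H H"
  have b: "(\<lambda>y z. pure_tensor R H H (S z) (S y)) \<in> bilinear_maps R H H ?HH"
    by (intro multilinear | assumption)+
  have "tensor_flip R H H (\<Delta> (S x)) =
      tensor_flip R H H (sweedler R H ?HH (\<lambda>y z. pure_tensor R H H (S z) (S y)) x)"
    by (simp only: comult_antipode[OF x])
  also have "\<dots> = sweedler R H ?HH (\<lambda>y z. tensor_flip R H H (pure_tensor R H H (S z) (S y))) x"
    by (rule linear_maps_sweedler[OF HH.module_T HH.module_T
          tensor_flip_linear[OF HH.tensor_product_axioms] b x])
  also have "\<dots> = sweedler R H ?HH (\<lambda>y z. pure_tensor R H H (S y) (S z)) x"
    by (rule sweedler_cong[OF HH.module_T bilinear_maps_compose[OF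
            tensor_flip_linear[OF HH.tensor_product_axioms] b] _ x])
      (simp add: tensor_flip_def
        HH.tensor_lift_pure[OF HH.module_T tensor_flip_bilinear[OF HH.tensor_product_axioms]])
  finally show "comult Hoc (S x) = tensor_map R Hoc Hoc S S (\<Delta> x)"
    by (simp add: tensor_map_def sweedler_def)
  show "counit Hoc (S x) = \<epsilon> x" using counit_antipode[OF x] by simp
qed

end

section \<open>Hopf morphisms\<close>

context hopf_hom
begin

text \<open>Compatibility of \<open>f\<close> with the comultiplications, as a rule for Sweedler sums: the components of
  \<open>f x\<close> are the images of the components of \<open>x\<close>.\<close>

lemma sweedler_hom:
  assumes P: "module R P" and b: "b \<in> bilinear_maps R K K P" and x: "x \<in> carrier H"
  shows "sweedler R H P (\<lambda>y z. b (f y) (f z)) x = sweedler R K P b (f x)"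
  unfolding sweedler_def hom_comult[OF x]
  by (rule tensor_lift_map[OF H.HH.tensor_product_axioms K.HH.tensor_product_axioms P
        hom_linear hom_linear b H.comult_closed[OF x], symmetric])

lemma hom_closed: "x \<in> carrier H \<Longrightarrow> f x \<in> carrier K"
  by (rule linear_maps_closed[OF hom_linear])

text \<open>Since \<open>f\<close> is a map of coalgebras, the antipode law of \<open>K\<close> at \<open>f x\<close> says that \<open>S\<^sub>K \<circ> f\<close> is a
  convolution inverse of \<open>f\<close>.\<close>

lemma antipode_after_hom_left_inverse:
  assumes x: "x \<in> carrier H"
  shows "H.convolution K (\<lambda>x. antipode K (f x)) f x = counit H x \<odot>\<^bsub>K\<^esub> \<one>\<^bsub>K\<^esub>"
proof -
  have "sweedler R H K (\<lambda>y z. antipode K (f y) \<otimes>\<^bsub>K\<^esub> f z) x =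
      sweedler R K K (\<lambda>y z. antipode K y \<otimes>\<^bsub>K\<^esub> z) (f x)"
    by (rule sweedler_hom[OF K.module_axioms _ x]) (intro K.multilinear | assumption)+
  then show ?thesis
    by (simp add: H.convolution_def K.sweedler_antipode_left hom_closed hom_counit x)
qed

lemma antipode_after_hom_right_inverse:
  assumes x: "x \<in> carrier H"
  shows "H.convolution K f (\<lambda>x. antipode K (f x)) x = counit H x \<odot>\<^bsub>K\<^esub> \<one>\<^bsub>K\<^esub>"
proof -
  have "sweedler R H K (\<lambda>y z. f y \<otimes>\<^bsub>K\<^esub> antipode K (f z)) x =
      sweedler R K K (\<lambda>y z. y \<otimes>\<^bsub>K\<^esub> antipode K z) (f x)"
    by (rule sweedler_hom[OF K.module_axioms _ x]) (intro K.multilinear | assumption)+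
  then show ?thesis
    by (simp add: H.convolution_def K.sweedler_antipode_right hom_closed hom_counit x)
qed

text \<open>Since \<open>f\<close> is a map of algebras, the image under \<open>f\<close> of the antipode law of \<open>H\<close> at \<open>x\<close> says
  that \<open>f \<circ> S\<^sub>H\<close> is a convolution inverse of \<open>f\<close>.\<close>

lemma hom_after_antipode_right_inverse:
  assumes x: "x \<in> carrier H"
  shows "H.convolution K f (\<lambda>x. f (antipode H x)) x = counit H x \<odot>\<^bsub>K\<^esub> \<one>\<^bsub>K\<^esub>"
proof -
  have b: "(\<lambda>y z. y \<otimes>\<^bsub>H\<^esub> antipode H z) \<in> bilinear_maps R H H H"
    by (intro H.multilinear | assumption)+
  have "H.convolution K f (\<lambda>x. f (antipode H x)) x =
      sweedler R H K (\<lambda>y z. f (y \<otimes>\<^bsub>H\<^esub> antipode H z)) x"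
    unfolding H.convolution_def
    by (rule H.sweedler_cong[OF K.module_axioms bilinear_maps_compose[OF hom_linear b] _ x, symmetric])
      (simp add: ring_hom_mult[OF hom_ring_hom])
  also have "\<dots> = f (sweedler R H H (\<lambda>y z. y \<otimes>\<^bsub>H\<^esub> antipode H z) x)"
    by (rule H.linear_maps_sweedler[OF H.module_axioms K.module_axioms hom_linear b x, symmetric])
  also have "\<dots> = counit H x \<odot>\<^bsub>K\<^esub> \<one>\<^bsub>K\<^esub>"
    using x by (simp add: H.sweedler_antipode_right linear_maps_smult[OF hom_linear]
        ring_hom_one[OF hom_ring_hom])
  finally show ?thesis .
qed

lemma hom_after_antipode_left_inverse:
  assumes x: "x \<in> carrier H"
  shows "H.convolution K (\<lambda>x. f (antipode H x)) f x = counit H x \<odot>\<^bsub>K\<^esub> \<one>\<^bsub>K\<^esub>"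
proof -
  have b: "(\<lambda>y z. antipode H y \<otimes>\<^bsub>H\<^esub> z) \<in> bilinear_maps R H H H"
    by (intro H.multilinear | assumption)+
  have "H.convolution K (\<lambda>x. f (antipode H x)) f x =
      sweedler R H K (\<lambda>y z. f (antipode H y \<otimes>\<^bsub>H\<^esub> z)) x"
    unfolding H.convolution_def
    by (rule H.sweedler_cong[OF K.module_axioms bilinear_maps_compose[OF hom_linear b] _ x, symmetric])
      (simp add: ring_hom_mult[OF hom_ring_hom])
  also have "\<dots> = f (sweedler R H H (\<lambda>y z. antipode H y \<otimes>\<^bsub>H\<^esub> z) x)"
    by (rule H.linear_maps_sweedler[OF H.module_axioms K.module_axioms hom_linear b x, symmetric])
  also have "\<dots> = counit H x \<odot>\<^bsub>K\<^esub> \<one>\<^bsub>K\<^esub>"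
    using x by (simp add: H.sweedler_antipode_left linear_maps_smult[OF hom_linear]
        ring_hom_one[OF hom_ring_hom])
  finally show ?thesis .
qed

end

text \<open>Left cancellation of the antipode: \<open>g\<close> and \<open>h\<close> have the same convolution inverse.\<close>

lemma hopf_hom_eqI_antipode_after:
  assumes g: "hopf_hom R L H g" and h: "hopf_hom R L H h"
    and eq: "\<And>x. x \<in> carrier L \<Longrightarrow> antipode H (g x) = antipode H (h x)"
    and x: "x \<in> carrier L"
  shows "g x = h x"
proof -
  interpret g: hopf_hom R L H g by fact
  interpret h: hopf_hom R L H h by fact
  note A = g.K.assoc_algebra_axioms
  note Sg = linear_maps_compose[OF g.K.antipode_linear g.hom_linear]
  note Sh = linear_maps_compose[OF g.K.antipode_linear h.hom_linear]
  have inv: "g.H.convolution H (\<lambda>x. antipode H (g x)) h y = counit L y \<odot>\<^bsub>H\<^esub> \<one>\<^bsub>H\<^esub>"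
    if "y \<in> carrier L" for y
    using g.H.convolution_cong[OF A Sg h.hom_linear eq refl that] h.antipode_after_hom_left_inverse[OF that]
    by simp
  show ?thesis
    by (rule g.H.convolution_inverse_unique[OF A g.hom_linear Sg h.hom_linear
          g.antipode_after_hom_right_inverse inv x])
qed

text \<open>Right cancellation of the antipode, again because inverses are unique; here the common inverse of
  \<open>g\<close> and \<open>h\<close> is \<open>g \<circ> S\<^sub>K\<close>.\<close>

lemma hopf_hom_eqI_after_antipode:
  assumes g: "hopf_hom R K L g" and h: "hopf_hom R K L h"
    and eq: "\<And>x. x \<in> carrier K \<Longrightarrow> g (antipode K x) = h (antipode K x)"
    and x: "x \<in> carrier K"
  shows "g x = h x"
proof -
  interpret g: hopf_hom R K L g by fact
  interpret h: hopf_hom R K L h by fact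
  note A = g.K.assoc_algebra_axioms
  note gS = linear_maps_compose[OF g.hom_linear g.H.antipode_linear]
  have inv: "g.H.convolution L (\<lambda>x. g (antipode K x)) h y = counit K y \<odot>\<^bsub>L\<^esub> \<one>\<^bsub>L\<^esub>"
    if "y \<in> carrier K" for y
    using g.H.convolution_cong[OF A gS h.hom_linear eq refl that] h.hom_after_antipode_left_inverse[OF that]
    by simp
  show ?thesis
    by (rule g.H.convolution_inverse_unique[OF A g.hom_linear gS h.hom_linear
          g.hom_after_antipode_right_inverse inv x])
qed

theorem proposition2p1:
  fixes k :: "'k ring" and H :: "('k, 'h) hopf"
  assumes "field k" and "hopf_algebra k H"
  shows "hopf_epimorphism TYPE('t) k H (op_cop k H) (antipode H) \<and>
    hopf_monomorphism TYPE('t) k H (op_cop k H) (antipode H)"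
proof
  interpret hopf_algebra k H by fact
  show "hopf_epimorphism TYPE('t) k H (op_cop k H) (antipode H)"
    unfolding hopf_epimorphism_def
  proof (intro conjI allI impI ballI)
    show "hopf_hom k H (op_cop k H) (antipode H)" by (rule antipode_hopf_hom)
    fix L :: "('k, 't) hopf" and g h x
    assume gh: "hopf_hom k (op_cop k H) L g" "hopf_hom k (op_cop k H) L h"
      and eq: "\<forall>x\<in>carrier H. g (antipode H x) = h (antipode H x)"
      and x: "x \<in> carrier (op_cop k H)"
    \<comment> \<open>The source of \<open>g\<close> and \<open>h\<close> is \<open>H\<^sup>o\<^sup>p\<^sup>,\<^sup>c\<^sup>o\<^sup>p\<close>, and its antipode is the antipode of \<open>H\<close>.\<close>
    show "g x = h x"
      by (rule hopf_hom_eqI_after_antipode[OF gh _ x]) (use eq in simp)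
  qed
  show "hopf_monomorphism TYPE('t) k H (op_cop k H) (antipode H)"
    unfolding hopf_monomorphism_def
  proof (intro conjI allI impI ballI)
    show "hopf_hom k H (op_cop k H) (antipode H)" by (rule antipode_hopf_hom)
    fix L :: "('k, 't) hopf" and g h x
    assume gh: "hopf_hom k L H g" "hopf_hom k L H h"
      and eq: "\<forall>x\<in>carrier L. antipode H (g x) = antipode H (h x)"
      and x: "x \<in> carrier L"
    show "g x = h x"
      by (rule hopf_hom_eqI_antipode_after[OF gh _ x]) (use eq in simp)
  qed
qed

end
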